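(* For positive integers $h$, $w$, and $n$, $$ \det_{1\le i,j\le h}\left(F_{-i+j,2h+2w+1}(x_1,\dots,x_n)-F_{i+j,2h+2w+1}(x_1,\dots,x_n)\right)=\sum_{(T,M)\in\mathrm{UD}_n(h,w^* )}\omega(T,M), $$ $$ \det_{1\le i,j\le h}\left(\overline F_{-i+j,2h+2w+1}(x_1,\dots,x_n)+\overline F_{i+j-1,2h+2w+1}(x_1,\dots,x_n)\right)=\sum_{(T,M)\in\mathrm{UD}_n(h^*,w)}\omega(T,M), $$ $$ \det_{1\le i,j\le h}\left(\overline F_{-i+j,2h+2w}(x_1,\dots,x_n)+\overline F_{i+j-1,2h+2w}(x_1,\dots,x_n)\right)=\sum_{(T,M_1,M_2)\in\mathrm{UD}_n(h^*,w^* )}\omega(T,M_1,M_2). $$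
   Context: $e_k(x_1,\dots,x_n)$ is the $k$-th elementary symmetric polynomial ($e_0=1$; $e_k=0$ for $k<0$ or $k>n$). $f_r=\sum_{i\in\mathbb Z}e_ie_{i+r}$, $F_{r,N}=\sum_{k\in\mathbb Z}f_{r+Nk}$, $\overline F_{r,N}=\sum_{k\in\mathbb Z}(-1)^kf_{r+Nk}$, all evaluated at $x_1,\dots,x_n$. Partitions have $\lambda_i=0$ for $i$ larger than the number of parts. $\mathrm{UD}_n(h,w)$ is the set of $(h,w)$-up-down tableaux, i.e. sequences $(\lambda^0,\lambda^1,\dots,\lambda^{2n})$ of partitions such that: (i) $\emptyset=\lambda^0\subseteq\lambda^1\supseteq\lambda^2\subseteq\lambda^3\supseteq\lambda^4\subseteq\dots\subseteq\lambda^{2n-1}\supseteq\lambda^{2n}=\emptyset$ (containment of Young diagrams); (ii) each pair $(\lambda^{i-1},\lambda^i)$ differs by a vertical strip, that is, by a collection of cells containing at most one cell in each row, $i=1,\dots,2n$; (iii) each $\lambda^i$ has at most $h$ rows, $i=1,\dots,2n$; (iv) each $\lambda^{2i}$ has at most $w$ columns, $i=1,\dots,n$. The weight is $\omega(T)=\prod_{i=1}^n x_i^{-|\lambda^{2i-2}|+2|\lambda^{2i-1}|-|\lambda^{2i}|}$. $\mathrm{UD}_n(h^*,w)$ is the set of pairs $(T,M)$ with $T=(\lambda^0,\dots,\lambda^{2n})\in\mathrm{UD}_n(h,w)$ and $M\subseteq\{1,\dots,n\}$ such that $j\in M$ implies $\lambda^{2j-1}_h=0$; its weight is $\omega(T,M)=\omega(T)\prod_{j\in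 M}x_j$. $\mathrm{UD}_n(h,w^* )$ is the set of pairs $(T,M)$ with $T\in\mathrm{UD}_n(h,w)$ and $M\subseteq\{1,\dots,n\}$ such that $j\in M$ implies $\lambda^{2j-1}_1=w+1$; its weight is $\omega(T,M)=\omega(T)\prod_{j\in M}\left(-\frac1{x_j}\right)$. $\mathrm{UD}_n(h^*,w^* )$ is the set of triples $(T,M_1,M_2)$ with $T\in\mathrm{UD}_n(h,w)$ and $M_1,M_2\subseteq\{1,\dots,n\}$ such that $j\in M_1$ implies $\lambda^{2j-1}_h=0$ and $j\in M_2$ implies $\lambda^{2j-1}_1=w+1$; its weight is $\omega(T,M_1,M_2)=\omega(T)\prod_{j\in M_1}x_j\prod_{j\in M_2}\left(-\frac1{x_j}\right)$. *)

theory Defs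
  imports
    Complex_Main
    "HOL-Library.Groups_Big_Fun"
    "Jordan_Normal_Form.Determinant"
begin

section \<open>Elementary symmetric polynomials and the sums built from them\<close>

text \<open>The variables are \<open>x 1, \<dots>, x n\<close>, arbitrary elements of a field. The index \<open>k\<close> ranges
  over the integers; for \<open>k < 0\<close> and for \<open>k > n\<close> no subset has \<open>k\<close> elements and the value is 0.\<close>

definition esym :: "nat \<Rightarrow> (nat \<Rightarrow> 'a::field) \<Rightarrow> int \<Rightarrow> 'a" where
  "esym n x k = (\<Sum>S | S \<subseteq> {1..n} \<and> int (card S) = k. \<Prod>i\<in>S. x i)"

text \<open>\<^const>\<open>Sum_any\<close> sums a finitely supported function over its whole type, here the integers.
  All sums below have finite support, in the last two definitions because they are used with
  \<open>N > 0\<close> only.\<close>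

definition f_sum :: "nat \<Rightarrow> (nat \<Rightarrow> 'a::field) \<Rightarrow> int \<Rightarrow> 'a" where
  "f_sum n x r = Sum_any (\<lambda>i::int. esym n x i * esym n x (i + r))"

definition F_sum :: "nat \<Rightarrow> (nat \<Rightarrow> 'a::field) \<Rightarrow> int \<Rightarrow> int \<Rightarrow> 'a" where
  "F_sum n x r N = Sum_any (\<lambda>k::int. f_sum n x (r + N * k))"

definition Fbar_sum :: "nat \<Rightarrow> (nat \<Rightarrow> 'a::field) \<Rightarrow> int \<Rightarrow> int \<Rightarrow> 'a" where
  "Fbar_sum n x r N = Sum_any (\<lambda>k::int. (- 1) powi k * f_sum n x (r + N * k))"

text \<open>Entries are specified with row and column indices starting at 1, whereas \<^const>\<open>mat\<close>
  counts from 0.\<close>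

definition det1 :: "nat \<Rightarrow> (int \<Rightarrow> int \<Rightarrow> 'a::field) \<Rightarrow> 'a" where
  "det1 h a = det (mat h h (\<lambda>(i, j). a (int i + 1) (int j + 1)))"


section \<open>Partitions\<close>

text \<open>A partition is a weakly decreasing, eventually zero function on the naturals, indexed from 0:
  the part \<open>\<lambda>\<^sub>i\<close> is \<open>l (i - 1)\<close>.\<close>

definition is_partition :: "(nat \<Rightarrow> nat) \<Rightarrow> bool" where
  "is_partition l \<longleftrightarrow> antimono l \<and> finite {i. l i \<noteq> 0}"

definition part :: "(nat \<Rightarrow> nat) \<Rightarrow> nat \<Rightarrow> nat" where
  "part l i = l (i - 1)"

definition empty_partition :: "nat \<Rightarrow> nat" where
  "empty_partition = (\<lambda>_. 0)"

definition psize :: "(nat \<Rightarrow> nat) \<Rightarrow> nat" where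
  "psize l = (\<Sum>i | l i \<noteq> 0. l i)"

definition num_rows :: "(nat \<Rightarrow> nat) \<Rightarrow> nat" where
  "num_rows l = card {i. l i \<noteq> 0}"

definition num_cols :: "(nat \<Rightarrow> nat) \<Rightarrow> nat" where
  "num_cols l = part l 1"

definition young :: "(nat \<Rightarrow> nat) \<Rightarrow> (nat \<times> nat) set" where
  "young l = {(i, j). j < l i}"

definition differ_by_vertical_strip :: "(nat \<Rightarrow> nat) \<Rightarrow> (nat \<Rightarrow> nat) \<Rightarrow> bool" where
  "differ_by_vertical_strip l m \<longleftrightarrow>
     (\<forall>i j j'. (i, j) \<in> (young l - young m) \<union> (young m - young l) \<longrightarrow>
               (i, j') \<in> (young l - young m) \<union> (young m - young l) \<longrightarrow> j = j')"


section \<open>Up-down tableaux\<close>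

text \<open>A tableau is the list \<open>T\<close> of its partitions, \<open>T ! i\<close> being \<open>\<lambda>\<^sup>i\<close>.\<close>

definition UD :: "nat \<Rightarrow> nat \<Rightarrow> nat \<Rightarrow> (nat \<Rightarrow> nat) list set" where
  "UD n h w = {T. length T = 2 * n + 1 \<and>
     (\<forall>l \<in> set T. is_partition l) \<and>
     T ! 0 = empty_partition \<and> T ! (2 * n) = empty_partition \<and>
     (\<forall>i \<in> {1..n}. young (T ! (2 * i - 2)) \<subseteq> young (T ! (2 * i - 1)) \<and>
                   young (T ! (2 * i)) \<subseteq> young (T ! (2 * i - 1))) \<and>
     (\<forall>i \<in> {1..2 * n}. differ_by_vertical_strip (T ! (i - 1)) (T ! i)) \<and>
     (\<forall>i \<in> {1..2 * n}. num_rows (T ! i) \<le> h) \<and>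
     (\<forall>i \<in> {1..n}. num_cols (T ! (2 * i)) \<le> w)}"

definition weight :: "nat \<Rightarrow> (nat \<Rightarrow> 'a::field) \<Rightarrow> (nat \<Rightarrow> nat) list \<Rightarrow> 'a" where
  "weight n x T =
     (\<Prod>i = 1..n. x i powi
        (- int (psize (T ! (2 * i - 2))) + 2 * int (psize (T ! (2 * i - 1)))
         - int (psize (T ! (2 * i)))))"

definition UD_hstar :: "nat \<Rightarrow> nat \<Rightarrow> nat \<Rightarrow> ((nat \<Rightarrow> nat) list \<times> nat set) set" where
  "UD_hstar n h w = {(T, M). T \<in> UD n h w \<and> M \<subseteq> {1..n} \<and>
     (\<forall>j \<in> M. part (T ! (2 * j - 1)) h = 0)}"

definition weight_hstar :: "nat \<Rightarrow> (nat \<Rightarrow> 'a::field) \<Rightarrow> (nat \<Rightarrow> nat) list \<times> nat set \<Rightarrow> 'a" where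
  "weight_hstar n x = (\<lambda>(T, M). weight n x T * (\<Prod>j\<in>M. x j))"

definition UD_wstar :: "nat \<Rightarrow> nat \<Rightarrow> nat \<Rightarrow> ((nat \<Rightarrow> nat) list \<times> nat set) set" where
  "UD_wstar n h w = {(T, M). T \<in> UD n h w \<and> M \<subseteq> {1..n} \<and>
     (\<forall>j \<in> M. part (T ! (2 * j - 1)) 1 = w + 1)}"

definition weight_wstar :: "nat \<Rightarrow> (nat \<Rightarrow> 'a::field) \<Rightarrow> (nat \<Rightarrow> nat) list \<times> nat set \<Rightarrow> 'a" where
  "weight_wstar n x = (\<lambda>(T, M). weight n x T * (\<Prod>j\<in>M. - (1 / x j)))"

definition UD_hwstar ::
    "nat \<Rightarrow> nat \<Rightarrow> nat \<Rightarrow> ((nat \<Rightarrow> nat) list \<times> nat set \<times> nat set) set" where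
  "UD_hwstar n h w = {(T, M1, M2). T \<in> UD n h w \<and> M1 \<subseteq> {1..n} \<and> M2 \<subseteq> {1..n} \<and>
     (\<forall>j \<in> M1. part (T ! (2 * j - 1)) h = 0) \<and>
     (\<forall>j \<in> M2. part (T ! (2 * j - 1)) 1 = w + 1)}"

definition weight_hwstar ::
    "nat \<Rightarrow> (nat \<Rightarrow> 'a::field) \<Rightarrow> (nat \<Rightarrow> nat) list \<times> nat set \<times> nat set \<Rightarrow> 'a" where
  "weight_hwstar n x =
     (\<lambda>(T, M1, M2). weight n x T * (\<Prod>j\<in>M1. x j) * (\<Prod>j\<in>M2. - (1 / x j)))"

end

theory Submission
  imports Defs
begin

text \<open>A partition \<open>l\<close> with at most \<open>h\<close> rows is a configuration of \<open>h\<close> walkers at the distinct sites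
  \<open>l (h - 1 - j) + j + 1\<close> for \<open>j < h\<close>. Adding or removing a vertical strip moves some of the
  walkers by one site in the same direction. So an up-down tableau describes \<open>h\<close> nonintersecting walks from
  \<open>1, \<dots>, h\<close> back to \<open>1, \<dots>, h\<close>, which are confined to the sites \<open>1, \<dots>, h + w\<close> after each double step.
  A mark at an empty last row, or at a first row of length \<open>w + 1\<close>, gives the weight
  \<open>\<alpha> k = 1 + x k\<close> to the bottom site, or \<open>\<beta> k = 1 - 1 / x k\<close> to the top site \<open>h + w + 1\<close>,
  in the middle of the \<open>k\<close>-th double step. Such weights belong to the single walkers. The sum over
  the tableaux is therefore the determinant of the generating functions of a single walker
  (\<open>walker_det_eq_tableau_sum\<close>). This follows by expanding the determinant one half step at a
  time: each column is a sum of two terms, and the terms in which two walkers collide have two equal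
  columns (\<open>strip_expansion\<close>).

  The generating function of a single walker is found by the method of images. On all
  integers, without walls, the walks have the generating function \<^const>\<open>f_sum\<close>. In a double step
  that returns from the top site, \<open>x\<^sup>2\<close> becomes
  \<open>x\<^sup>2 * (1 - 1 / x) = x\<^sup>2 - x\<close>, which amounts to a wall at \<open>h + w + 1/2\<close> about which the
  walks are antisymmetric; without the weight they vanish at \<open>h + w + 1\<close>. At the bottom, 1 becomes
  \<open>1 + x\<close>, which amounts to a wall at \<open>1/2\<close> about which the walks are symmetric; without the weight
  they vanish at 0 (\<open>walk_eq_reflected\<close>). The composition of the reflections about the two walls is
  the translation by twice their distance, that is, by \<open>2 * h + 2 * w + 1\<close> if one of the weights is present
  and by \<open>2 * h + 2 * w\<close> if both are. Its sign is \<open>1\<close> if both reflections are antisymmetric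
  and \<open>- 1\<close> otherwise. So the sums over all images are the entries of the three determinants.\<close>

section \<open>Determinants with two-term columns\<close>

lemma det_mat_by_columns:
  fixes f :: "nat \<times> nat \<Rightarrow> 'a::field"
  shows "det (mat h h f) = (\<Sum>p | p permutes {0..<h}. signof p * (\<Prod>j<h. f (p j, j)))"
proof -
  have "mat h h f $$ (p j, j) = f (p j, j)" if "p permutes {0..<h}" "j < h" for p j
    using that permutes_in_image[of p "{0..<h}" j] by auto
  then show ?thesis
    by (subst det_col[of _ h]) (auto intro!: sum.cong prod.cong)
qed

text \<open>The multilinearity of the determinant in its columns, applied to all columns at once. Leibniz'
  formula turns it into the expansion of a product of two-term sums.\<close>

lemma det_add_columns:
  fixes u v :: "nat \<Rightarrow> nat \<Rightarrow> 'a::field"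
  shows "det (mat h h (\<lambda>(i, j). u i j + v i j)) =
    (\<Sum>S \<in> Pow {..<h}. det (mat h h (\<lambda>(i, j). if j \<in> S then v i j else u i j)))"
proof -
  have split: "(\<Prod>j<h. u (p j) j + v (p j) j) =
      (\<Sum>S\<in>Pow {..<h}. \<Prod>j<h. if j \<in> S then v (p j) j else u (p j) j)" for p
  proof -
    have "(\<Prod>j<h. v (p j) j + u (p j) j) =
        (\<Sum>S\<in>Pow {..<h}. (\<Prod>j\<in>S. v (p j) j) * (\<Prod>j\<in>{..<h} - S. u (p j) j))"
      by (rule prod_add) simp
    also have "\<dots> = (\<Sum>S\<in>Pow {..<h}. \<Prod>j<h. if j \<in> S then v (p j) j else u (p j) j)"
    proof (rule sum.cong[OF refl])
      fix S assume "S \<in> Pow {..<h}"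
      then have "{..<h} \<inter> S = S" "{..<h} \<inter> - S = {..<h} - S" by auto
      then show "(\<Prod>j\<in>S. v (p j) j) * (\<Prod>j\<in>{..<h} - S. u (p j) j) =
          (\<Prod>j<h. if j \<in> S then v (p j) j else u (p j) j)"
        by (simp add: prod.If_cases)
    qed
    finally show ?thesis by (simp add: add.commute)
  qed
  show ?thesis
    unfolding det_mat_by_columns by (simp add: split sum_distrib_left) (rule sum.swap)
qed

lemma det_scale_columns:
  fixes u :: "nat \<Rightarrow> nat \<Rightarrow> 'a::field"
  shows "det (mat h h (\<lambda>(i, j). c j * u i j)) = (\<Prod>j<h. c j) * det (mat h h (\<lambda>(i, j). u i j))"
  unfolding det_mat_by_columns by (simp add: sum_distrib_left prod.distrib mult.left_commute)

lemma det_zero_column: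
  fixes u :: "nat \<Rightarrow> nat \<Rightarrow> 'a::field"
  assumes "k < h" and "\<And>i. i < h \<Longrightarrow> u i k = 0"
  shows "det (mat h h (\<lambda>(i, j). u i j)) = 0"
proof -
  let ?c = "\<lambda>j. if j = k then 0 else 1 :: 'a"
  have "mat h h (\<lambda>(i, j). u i j) = mat h h (\<lambda>(i, j). ?c j * u i j)"
    using assms by (intro eq_matI) auto
  also have "det \<dots> = (\<Prod>j<h. ?c j) * det (mat h h (\<lambda>(i, j). u i j))"
    by (rule det_scale_columns)
  also have "(\<Prod>j<h. ?c j) = 0"
    using assms by (intro prod_zero) auto
  finally show ?thesis by simp
qed

lemma det_equal_columns:
  fixes u :: "nat \<Rightarrow> nat \<Rightarrow> 'a::field"
  assumes "j < h" "k < h" "j \<noteq> k" and "\<And>i. i < h \<Longrightarrow> u i j = u i k"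
  shows "det (mat h h (\<lambda>(i, j). u i j)) = 0"
proof -
  let ?A = "mat h h (\<lambda>(i, j). u i j)"
  have "det (transpose_mat ?A) = 0"
    using assms by (intro det_identical_rows[of _ h j k]) (auto intro!: eq_vecI)
  then show ?thesis by (simp add: det_transpose[of _ h])
qed

section \<open>Partitions as walker positions\<close>

text \<open>The Lindstroem-Gessel-Viennot determinant of \<open>h\<close> walkers that start at the sites
  \<open>1, \<dots>, h\<close> and end at the sites \<open>q 0, \<dots>, q (h - 1)\<close>; the value \<open>g i y\<close> is the generating
  function of the walks of a single walker from \<open>i\<close> to \<open>y\<close>.\<close>

definition walker_det :: "nat \<Rightarrow> (int \<Rightarrow> int \<Rightarrow> 'a::field) \<Rightarrow> (nat \<Rightarrow> int) \<Rightarrow> 'a" where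
  "walker_det h g q = det (mat h h (\<lambda>(i, j). g (int i + 1) (q j)))"

definition boxed :: "nat \<Rightarrow> nat \<Rightarrow> (nat \<Rightarrow> nat) set" where
  "boxed h a = {l. antimono l \<and> (\<forall>i\<ge>h. l i = 0) \<and> (\<forall>i. l i \<le> a)}"

text \<open>The rows are numbered from the bottom, so that the positions increase with \<open>j\<close> and the empty
  partition occupies exactly the sites \<open>1, \<dots>, h\<close>. The row of length \<open>l (h - 1 - j)\<close> is shifted by
  \<open>j + 1\<close>, which makes weakly decreasing rows into distinct positions.\<close>

definition position :: "nat \<Rightarrow> (nat \<Rightarrow> nat) \<Rightarrow> nat \<Rightarrow> int" where
  "position h l j = int (l (h - 1 - j)) + int j + 1"

text \<open>For \<open>d = 1\<close> the partition \<open>m\<close> arises from \<open>l\<close> by adding a vertical strip, for \<open>d = - 1\<close> by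
  removing one.\<close>

definition strip :: "int \<Rightarrow> (nat \<Rightarrow> nat) \<Rightarrow> (nat \<Rightarrow> nat) \<Rightarrow> bool" where
  "strip d l m \<longleftrightarrow> (\<forall>i. int (m i) = int (l i) \<or> int (m i) = int (l i) + d)"

lemma walker_det_cong:
  assumes "\<And>i j. i < h \<Longrightarrow> j < h \<Longrightarrow> f (int i + 1) (p j) = g (int i + 1) (q j)"
  shows "walker_det h f p = walker_det h g q"
proof -
  have "mat h h (\<lambda>(i, j). f (int i + 1) (p j)) = mat h h (\<lambda>(i, j). g (int i + 1) (q j))"
    using assms by (intro eq_matI) auto
  then show ?thesis by (simp add: walker_det_def)
qed

lemma finite_boxed [simp]: "finite (boxed h a)"
proof (rule finite_subset)
  show "boxed h a \<subseteq> {f. \<forall>i. (i \<in> {..<h} \<longrightarrow> f i \<in> {..a}) \<and> (i \<notin> {..<h} \<longrightarrow> f i = 0)}"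
    by (auto simp: boxed_def not_less)
  show "finite {f. \<forall>i. (i \<in> {..<h} \<longrightarrow> f i \<in> {..a}) \<and> (i \<notin> {..<h} \<longrightarrow> f i = (0::nat))}"
    by (rule finite_set_of_finite_funs) auto
qed

lemma position_strict_mono:
  assumes "antimono l" "j < k" "k < h"
  shows "position h l j < position h l k"
proof -
  have "l (h - 1 - j) \<le> l (h - 1 - k)" using assms by (auto intro: antimonoD)
  then show ?thesis using assms by (simp add: position_def)
qed

lemma partition_of_positions:
  fixes q :: "nat \<Rightarrow> int"
  assumes mono: "\<And>j k. j < k \<Longrightarrow> k < h \<Longrightarrow> q j < q k"
    and range: "\<And>j. j < h \<Longrightarrow> 1 \<le> q j \<and> q j \<le> int h + int a"
  obtains l where "l \<in> boxed h a" "\<And>j. j < h \<Longrightarrow> position h l j = q j"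
proof -
  have gap: "q k - q j \<ge> int k - int j" if "j \<le> k" "k < h" for j k
    using that
  proof (induction k)
    case (Suc k)
    then show ?case
      using mono[of k "Suc k"] by (cases "j = Suc k") auto
  qed simp
  have lo: "q j \<ge> int j + 1" if "j < h" for j
    using gap[of 0 j] range[of 0] that by auto
  have hi: "q j \<le> int a + int j + 1" if "j < h" for j
  proof -
    have "j \<le> h - 1" "h - 1 < h" using that by auto
    then show ?thesis using gap[of j "h - 1"] range[of "h - 1"] by (simp add: of_nat_diff)
  qed
  \<comment> \<open>Undo the shift in \<open>position\<close>.\<close>
  define l where "l r = (if r < h then nat (q (h - 1 - r) - int (h - 1 - r) - 1) else 0)" for r
  have "antimono l"
  proof (rule antimonoI)
    fix r s :: nat assume "r \<le> s"
    show "l s \<le> l r"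
    proof (cases "s < h")
      case True
      have "h - 1 - s \<le> h - 1 - r" using \<open>r \<le> s\<close> by simp
      then show ?thesis
        using True \<open>r \<le> s\<close> gap[of "h - 1 - s" "h - 1 - r"] unfolding l_def by (auto intro!: nat_mono)
    qed (simp add: l_def)
  qed
  moreover have "l r \<le> a" for r
    using hi[of "h - 1 - r"] unfolding l_def by auto
  moreover have "position h l j = q j" if "j < h" for j
    using that lo[of j] unfolding position_def l_def by simp
  ultimately show ?thesis
    using that[of l] by (auto simp: boxed_def l_def)
qed

text \<open>One step of the Lindstroem-Gessel-Viennot argument, in which each walker either stays or moves by
  \<open>d\<close>. Expanding the determinant along its two-term columns gives a sum over the sets \<open>S\<close> of walkers
  that move. As the distances are at least 1 and all moves have the same direction, the order
  of the walkers is never reversed; hence either two of them collide, and the determinant has two equal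
  columns, or one of them leaves the sites \<open>1, \<dots>, h + a\<close>, and its column is zero, or the new positions
  are those of a partition. This replaces the usual sign-reversing
  involution and the Cauchy-Binet formula.\<close>

lemma strip_expansion:
  fixes g :: "int \<Rightarrow> int \<Rightarrow> 'a::field"
  assumes m: "antimono m" "\<And>i. i \<ge> h \<Longrightarrow> m i = 0" and d: "d = 1 \<or> d = - 1"
    and outside: "\<And>i y. y < 1 \<or> y > int h + int a \<Longrightarrow> g i y = 0"
  shows "walker_det h (\<lambda>i y. g i y + c * g i (y - d)) (position h m) =
    (\<Sum>l | l \<in> boxed h a \<and> strip d l m. c ^ card {i. l i \<noteq> m i} * walker_det h g (position h l))"
proof -
  define q where "q S j = position h m j - (if j \<in> S then d else 0)" for S j
  define moved where "moved l = {j. j < h \<and> l (h - 1 - j) \<noteq> m (h - 1 - j)}" for l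
  let ?L = "{l. l \<in> boxed h a \<and> strip d l m}"
  have "walker_det h (\<lambda>i y. g i y + c * g i (y - d)) (position h m) =
      (\<Sum>S\<in>Pow {..<h}. det (mat h h (\<lambda>(i, j). if j \<in> S then c * g (int i + 1) (position h m j - d)
                                               else g (int i + 1) (position h m j))))"
    unfolding walker_det_def by (rule det_add_columns)
  also have "\<dots> = (\<Sum>S\<in>Pow {..<h}. c ^ card S * walker_det h g (q S))"
  proof (rule sum.cong[OF refl])
    fix S assume "S \<in> Pow {..<h}"
    then have S: "{..<h} \<inter> S = S" by auto
    have "det (mat h h (\<lambda>(i, j). if j \<in> S then c * g (int i + 1) (position h m j - d)
            else g (int i + 1) (position h m j))) =
        det (mat h h (\<lambda>(i, j). (if j \<in> S then c else 1) * g (int i + 1) (q S j)))"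
      by (intro arg_cong[where f = det] eq_matI) (auto simp: q_def)
    also have "\<dots> = (\<Prod>j<h. if j \<in> S then c else 1) * walker_det h g (q S)"
      unfolding walker_det_def by (rule det_scale_columns)
    also have "(\<Prod>j<h. if j \<in> S then c else 1) = c ^ card S"
      by (simp add: prod.If_cases S)
    finally show "det (mat h h (\<lambda>(i, j). if j \<in> S then c * g (int i + 1) (position h m j - d)
            else g (int i + 1) (position h m j))) = c ^ card S * walker_det h g (q S)" .
  qed
  also have "\<dots> = (\<Sum>S\<in>moved ` ?L. c ^ card S * walker_det h g (q S))"
  proof (rule sum.mono_neutral_right)
    show "moved ` ?L \<subseteq> Pow {..<h}" by (auto simp: moved_def)
    show "\<forall>S\<in>Pow {..<h} - moved ` ?L. c ^ card S * walker_det h g (q S) = 0"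
    proof
      fix S assume S: "S \<in> Pow {..<h} - moved ` ?L"
      have "walker_det h g (q S) = 0"
      proof (rule ccontr)
        assume nz: "walker_det h g (q S) \<noteq> 0"
        have distinct: "q S j \<noteq> q S k" if "j < k" "k < h" for j k
          using nz that det_equal_columns[of j h k "\<lambda>i j. g (int i + 1) (q S j)"]
          unfolding walker_det_def by auto
        have range: "1 \<le> q S j \<and> q S j \<le> int h + int a" if "j < h" for j
        proof (rule ccontr)
          assume "\<not> ?thesis"
          then have "g i (q S j) = 0" for i by (intro outside) auto
          then show False
            using nz that det_zero_column[of j h "\<lambda>i j. g (int i + 1) (q S j)"]
            unfolding walker_det_def by auto
        qed
        \<comment> \<open>The positions of \<open>m\<close> differ by at least 1, and the difference shrinks by at most 1.\<close>
        have mono: "q S j < q S k" if "j < k" "k < h" for j k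
          using distinct[OF that] position_strict_mono[OF m(1) that] d unfolding q_def by auto
        obtain l where l: "l \<in> boxed h a" "\<And>j. j < h \<Longrightarrow> position h l j = q S j"
          using partition_of_positions[of h "q S" a, OF mono range] by blast
        have row: "int (l i) = int (m i) - (if h - 1 - i \<in> S then d else 0)" if "i < h" for i
          using l(2)[of "h - 1 - i"] that unfolding q_def position_def by simp
        have "strip d l m"
          unfolding strip_def
        proof
          fix i
          show "int (m i) = int (l i) \<or> int (m i) = int (l i) + d"
            using row[of i] m(2)[of i] l(1) by (cases "i < h") (auto simp: boxed_def)
        qed
        moreover have "moved l = S"
        proof -
          have "j \<in> moved l \<longleftrightarrow> j \<in> S" if "j < h" for j
            using row[of "h - 1 - j"] that d unfolding moved_def by (auto split: if_splits)
          then show ?thesis using S unfolding moved_def by auto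
        qed
        ultimately show False using S l(1) by auto
      qed
      then show "c ^ card S * walker_det h g (q S) = 0" by simp
    qed
  qed simp
  also have "\<dots> = (\<Sum>l\<in>?L. c ^ card (moved l) * walker_det h g (q (moved l)))"
  proof -
    have "inj_on moved ?L"
    proof (rule inj_onI, rule ext)
      fix l l' i assume A: "l \<in> ?L" "l' \<in> ?L" "moved l = moved l'"
      show "l i = l' i"
      proof (cases "i < h")
        case True
        have "h - 1 - i \<in> moved l \<longleftrightarrow> h - 1 - i \<in> moved l'" using A by simp
        then have "l i \<noteq> m i \<longleftrightarrow> l' i \<noteq> m i" using True by (simp add: moved_def)
        moreover have "int (m i) = int (l i) \<or> int (m i) = int (l i) + d"
          "int (m i) = int (l' i) \<or> int (m i) = int (l' i) + d"
          using A by (auto simp: strip_def)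
        ultimately show ?thesis by linarith
      qed (use A in \<open>auto simp: boxed_def\<close>)
    qed
    then show ?thesis by (simp add: sum.reindex)
  qed
  also have "\<dots> = (\<Sum>l\<in>?L. c ^ card {i. l i \<noteq> m i} * walker_det h g (position h l))"
  proof (rule sum.cong[OF refl])
    fix l assume l: "l \<in> ?L"
    have "bij_betw (\<lambda>j. h - 1 - j) (moved l) {i. l i \<noteq> m i}"
    proof (rule bij_betwI[where g = "\<lambda>j. h - 1 - j"])
      have "i < h" if "l i \<noteq> m i" for i
        using that l m(2)[of i] by (cases "i < h") (auto simp: boxed_def)
      then show "(\<lambda>j. h - 1 - j) \<in> {i. l i \<noteq> m i} \<rightarrow> moved l"
        by (fastforce simp: moved_def)
      show "h - 1 - (h - 1 - y) = y" if "y \<in> {i. l i \<noteq> m i}" for y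
        using \<open>\<And>i. l i \<noteq> m i \<Longrightarrow> i < h\<close>[of y] that by simp
    qed (auto simp: moved_def)
    then have "card (moved l) = card {i. l i \<noteq> m i}" by (rule bij_betw_same_card)
    moreover have "walker_det h g (q (moved l)) = walker_det h g (position h l)"
    proof (rule walker_det_cong)
      fix i j assume "j < h"
      moreover have "int (m (h - 1 - j)) = int (l (h - 1 - j)) \<or>
          int (m (h - 1 - j)) = int (l (h - 1 - j)) + d"
        using l by (auto simp: strip_def)
      ultimately have "q (moved l) j = position h l j"
        unfolding q_def moved_def position_def by (auto split: if_splits)
      then show "g (int i + 1) (q (moved l) j) = g (int i + 1) (position h l j)" by simp
    qed
    ultimately show "c ^ card (moved l) * walker_det h g (q (moved l)) =
        c ^ card {i. l i \<noteq> m i} * walker_det h g (position h l)" by simp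
  qed
  finally show ?thesis .
qed

section \<open>Walks in a strip with weighted boundary sites\<close>

text \<open>Up-down tableaux that end at an arbitrary partition \<open>v\<close> instead of the empty one, as an induction
  on the number of up-down steps needs them.\<close>

definition tableaux_to ::
    "nat \<Rightarrow> nat \<Rightarrow> nat \<Rightarrow> (nat \<Rightarrow> nat) \<Rightarrow> (nat \<Rightarrow> nat) list set" where
  "tableaux_to h w k v = {T. length T = 2 * k + 1 \<and> T ! 0 = empty_partition \<and> T ! (2 * k) = v \<and>
     (\<forall>i\<le>k. T ! (2 * i) \<in> boxed h w) \<and>
     (\<forall>i\<in>{1..k}. T ! (2 * i - 1) \<in> boxed h (w + 1) \<and>
        strip 1 (T ! (2 * i - 2)) (T ! (2 * i - 1)) \<and> strip 1 (T ! (2 * i)) (T ! (2 * i - 1)))}"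

lemma strip_uminus: "strip (- 1) l m \<longleftrightarrow> strip 1 m l"
  unfolding strip_def by (rule all_cong1) arith

lemma psize_boxed:
  assumes "l \<in> boxed h a"
  shows "psize l = (\<Sum>i<h. l i)"
  unfolding psize_def
proof (rule sum.mono_neutral_left)
  show "{i. l i \<noteq> 0} \<subseteq> {..<h}" using assms by (force simp: boxed_def not_less[symmetric])
qed auto

lemma psize_strip:
  assumes "l \<in> boxed h a" "m \<in> boxed h b" "strip 1 l m"
  shows "psize m = psize l + card {i. l i \<noteq> m i}"
proof -
  have step: "m i = l i + (if l i \<noteq> m i then 1 else 0)" for i
  proof -
    have "int (m i) = int (l i) \<or> int (m i) = int (l i) + 1" using assms(3) by (auto simp: strip_def)
    then show ?thesis by auto
  qed
  have sub: "{..<h} \<inter> {i. l i \<noteq> m i} = {i. l i \<noteq> m i}"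
    using assms by (force simp: boxed_def not_less[symmetric])
  have "psize m = (\<Sum>i<h. l i + (if l i \<noteq> m i then 1 else 0))"
    unfolding psize_boxed[OF assms(2)] using step by (intro sum.cong) auto
  also have "\<dots> = psize l + card {i. l i \<noteq> m i}"
    unfolding psize_boxed[OF assms(1)] sum.distrib by (simp add: sum.If_cases sub)
  finally show ?thesis .
qed

text \<open>A walker on the sites \<open>1, \<dots>, h + w\<close> makes double steps. In the first half of the \<open>k\<close>-th double
  step it may move up, in the second half it may move down, each move having weight \<open>x k\<close>. Between the
  halves it may also be at the site \<open>h + w + 1\<close>. The extra weights \<open>\<alpha> k\<close> and \<open>\<beta> k\<close> are
  collected by a walker that is at the bottom site 1 or at the top site \<open>h + w + 1\<close> at that moment;
  \<open>crest\<close> is the generating function at that moment.\<close>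

locale boundary_weighted_walks =
  fixes h w :: nat and x \<alpha> \<beta> :: "nat \<Rightarrow> 'a::field"
  assumes h_pos: "h \<ge> 1"
begin

definition site :: "nat \<Rightarrow> int \<Rightarrow> 'a" where
  "site k y = (if y = 1 then \<alpha> k else 1) * (if y = int h + int w + 1 then \<beta> k else 1)"

definition crest :: "nat \<Rightarrow> (int \<Rightarrow> int \<Rightarrow> 'a) \<Rightarrow> int \<Rightarrow> int \<Rightarrow> 'a" where
  "crest k g i y = site k y * (g i y + x k * g i (y - 1))"

primrec walk :: "nat \<Rightarrow> int \<Rightarrow> int \<Rightarrow> 'a" where
  "walk 0 i y = (if 1 \<le> y \<and> y \<le> int h + int w \<and> y = i then 1 else 0)"
| "walk (Suc k) i y = (if 1 \<le> y \<and> y \<le> int h + int w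
     then crest (Suc k) (walk k) i y + x (Suc k) * crest (Suc k) (walk k) i (y + 1) else 0)"

definition crest_weight :: "nat \<Rightarrow> (nat \<Rightarrow> nat) \<Rightarrow> 'a" where
  "crest_weight k m = (if part m h = 0 then \<alpha> k else 1) * (if part m 1 = w + 1 then \<beta> k else 1)"

definition tableau_weight :: "nat \<Rightarrow> (nat \<Rightarrow> nat) list \<Rightarrow> 'a" where
  "tableau_weight k T = weight k x T * (\<Prod>i = 1..k. crest_weight i (T ! (2 * i - 1)))"

lemma walk_outside: "y < 1 \<or> y > int h + int w \<Longrightarrow> walk k i y = 0"
  by (cases k) auto

lemma crest_outside: "y < 1 \<or> y > int h + int (w + 1) \<Longrightarrow> crest k (walk k') i y = 0"
  unfolding crest_def by (auto simp: walk_outside)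

text \<open>The walker of the last row is at the bottom site iff that row is empty, and the walker of the first
  row is at the top site iff that row has length \<open>w + 1\<close>; the other walkers never are at these sites.\<close>

lemma site_product:
  assumes "m \<in> boxed h (w + 1)"
  shows "(\<Prod>j<h. site k (position h m j)) = crest_weight k m"
proof -
  have m: "antimono m" "m i \<le> w + 1" for i using assms by (auto simp: boxed_def)
  have lo: "position h m j = 1 \<longleftrightarrow> j = 0 \<and> m (h - 1) = 0" for j
    unfolding position_def by (cases "j = 0") auto
  have hi: "position h m j = int h + int w + 1 \<longleftrightarrow> j = h - 1 \<and> m 0 = w + 1" if "j < h" for j
  proof -
    have "j = h - 1" if "position h m j = int h + int w + 1"
      using that \<open>j < h\<close> m(2)[of "h - 1 - j"] unfolding position_def by linarith
    moreover have "position h m (h - 1) = int (m 0) + int h"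
      using h_pos by (simp add: position_def)
    ultimately show ?thesis by auto
  qed
  have "(\<Prod>j<h. site k (position h m j)) =
      (\<Prod>j<h. if j = 0 then (if m (h - 1) = 0 then \<alpha> k else 1) else 1) *
      (\<Prod>j<h. if j = h - 1 then (if m 0 = w + 1 then \<beta> k else 1) else 1)"
    unfolding prod.distrib[symmetric]
    by (rule prod.cong[OF refl]) (simp add: site_def lo hi)
  also have "\<dots> = crest_weight k m"
    using h_pos by (simp add: crest_weight_def part_def)
  finally show ?thesis .
qed

lemma crest_det:
  assumes "m \<in> boxed h (w + 1)"
  shows "walker_det h (crest (Suc k) (walk k)) (position h m) =
    crest_weight (Suc k) m *
    (\<Sum>l | l \<in> boxed h w \<and> strip 1 l m.
        x (Suc k) ^ card {i. l i \<noteq> m i} * walker_det h (walk k) (position h l))"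
proof -
  have "walker_det h (crest (Suc k) (walk k)) (position h m) =
      (\<Prod>j<h. site (Suc k) (position h m j)) *
      walker_det h (\<lambda>i y. walk k i y + x (Suc k) * walk k i (y - 1)) (position h m)"
    unfolding walker_det_def crest_def by (rule det_scale_columns)
  also have "walker_det h (\<lambda>i y. walk k i y + x (Suc k) * walk k i (y - 1)) (position h m) =
    (\<Sum>l | l \<in> boxed h w \<and> strip 1 l m.
        x (Suc k) ^ card {i. l i \<noteq> m i} * walker_det h (walk k) (position h l))"
    using assms walk_outside by (intro strip_expansion) (auto simp: boxed_def)
  finally show ?thesis by (simp add: site_product[OF assms])
qed

lemma walk_det:
  assumes "v \<in> boxed h w"
  shows "walker_det h (walk (Suc k)) (position h v) =
    (\<Sum>m | m \<in> boxed h (w + 1) \<and> strip 1 v m.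
        x (Suc k) ^ card {i. v i \<noteq> m i} * walker_det h (crest (Suc k) (walk k)) (position h m))"
proof -
  let ?c = "crest (Suc k) (walk k)"
  have "walker_det h (walk (Suc k)) (position h v) =
      walker_det h (\<lambda>i y. ?c i y + x (Suc k) * ?c i (y - (- 1))) (position h v)"
  proof (rule walker_det_cong)
    fix i j assume "j < h"
    moreover have "v (h - 1 - j) \<le> w" using assms by (auto simp: boxed_def)
    ultimately have "1 \<le> position h v j" "position h v j \<le> int h + int w"
      by (auto simp: position_def)
    then show "walk (Suc k) (int i + 1) (position h v j) =
        ?c (int i + 1) (position h v j) + x (Suc k) * ?c (int i + 1) (position h v j - (- 1))"
      by simp
  qed
  also have "\<dots> = (\<Sum>m | m \<in> boxed h (w + 1) \<and> strip (- 1) m v.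
        x (Suc k) ^ card {i. m i \<noteq> v i} * walker_det h ?c (position h m))"
    using assms crest_outside by (intro strip_expansion) (auto simp: boxed_def)
  also have "\<dots> = (\<Sum>m | m \<in> boxed h (w + 1) \<and> strip 1 v m.
        x (Suc k) ^ card {i. v i \<noteq> m i} * walker_det h ?c (position h m))"
  proof (rule sum.cong)
    fix m
    have "{i. m i \<noteq> v i} = {i. v i \<noteq> m i}" by auto
    then show "x (Suc k) ^ card {i. m i \<noteq> v i} * walker_det h ?c (position h m) =
        x (Suc k) ^ card {i. v i \<noteq> m i} * walker_det h ?c (position h m)" by simp
  qed (simp add: strip_uminus)
  finally show ?thesis .
qed

text \<open>If \<open>v\<close> is not empty, then the walker of its first row is beyond \<open>h\<close>, where no walk has started.\<close>

lemma walk_det_0: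
  assumes "v \<in> boxed h w"
  shows "walker_det h (walk 0) (position h v) = (if v = empty_partition then 1 else 0)"
proof (cases "v = empty_partition")
  case True
  have "mat h h (\<lambda>(i, j). walk 0 (int i + 1) (position h v j)) = 1\<^sub>m h"
    unfolding True by (intro eq_matI) (auto simp: position_def empty_partition_def)
  then show ?thesis using True by (simp add: walker_det_def)
next
  case False
  have "v 0 \<noteq> 0"
  proof
    assume "v 0 = 0"
    then have "v i = 0" for i
      using assms antimonoD[of v 0 i] by (auto simp: boxed_def)
    then show False using False by (auto simp: empty_partition_def)
  qed
  then have "position h v (h - 1) > int h" using h_pos by (simp add: position_def)
  then have "walker_det h (walk 0) (position h v) = 0"
    unfolding walker_det_def using h_pos by (intro det_zero_column[of "h - 1"]) auto
  then show ?thesis using False by simp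
qed

lemma tableaux_to_0:
  "v \<in> boxed h w \<Longrightarrow>
    tableaux_to h w 0 v = (if v = empty_partition then {[empty_partition]} else {})"
  by (auto simp: tableaux_to_def length_Suc_conv)

lemma tableaux_to_Suc:
  assumes "v \<in> boxed h w"
  shows "bij_betw (\<lambda>(m, l, T). T @ [m, v])
    (SIGMA m:{m \<in> boxed h (w + 1). strip 1 v m}.
       SIGMA l:{l \<in> boxed h w. strip 1 l m}. tableaux_to h w k l)
    (tableaux_to h w (Suc k) v)"
proof (rule bij_betwI[where g = "\<lambda>T. (T ! (2 * k + 1), T ! (2 * k), take (2 * k + 1) T)"])
  let ?D = "SIGMA m:{m \<in> boxed h (w + 1). strip 1 v m}.
       SIGMA l:{l \<in> boxed h w. strip 1 l m}. tableaux_to h w k l"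
  let ?extend = "\<lambda>(m, l, T). T @ [m, v]"
  let ?strip_off = "\<lambda>T. (T ! (2 * k + 1), T ! (2 * k), take (2 * k + 1) T)"
  show "?extend \<in> ?D \<rightarrow> tableaux_to h w (Suc k) v"
  proof
    fix p assume "p \<in> ?D"
    then obtain m l T where p: "p = (m, l, T)" "m \<in> boxed h (w + 1)" "strip 1 v m"
      "l \<in> boxed h w" "strip 1 l m" and T: "T \<in> tableaux_to h w k l" by auto
    let ?T = "T @ [m, v]"
    have len: "length T = 2 * k + 1" and last: "T ! (2 * k) = l"
      using T by (auto simp: tableaux_to_def)
    have old: "?T ! i = T ! i" if "i \<le> 2 * k" for i using len that by (simp add: nth_append)
    have new: "?T ! (2 * Suc k - 1) = m" "?T ! (2 * Suc k) = v"
      using len by (simp_all add: nth_append)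
    have even: "?T ! (2 * i) \<in> boxed h w" if "i \<le> Suc k" for i
    proof (cases "i = Suc k")
      case False
      then show ?thesis using that T by (simp add: old tableaux_to_def)
    qed (use new assms in simp)
    have odd: "?T ! (2 * i - 1) \<in> boxed h (w + 1) \<and>
        strip 1 (?T ! (2 * i - 2)) (?T ! (2 * i - 1)) \<and> strip 1 (?T ! (2 * i)) (?T ! (2 * i - 1))"
      if "i \<in> {1..Suc k}" for i
    proof (cases "i = Suc k")
      case True
      then show ?thesis using p new old[of "2 * k"] last by simp
    next
      case False
      then have "i \<in> {1..k}" using that by auto
      then show ?thesis
        using T old[of "2 * i"] old[of "2 * i - 1"] old[of "2 * i - 2"]
        by (auto simp: tableaux_to_def)
    qed
    have "?T \<in> tableaux_to h w (Suc k) v"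
      using len new old[of 0] T even odd unfolding tableaux_to_def by auto
    then show "?extend p \<in> tableaux_to h w (Suc k) v" by (simp add: p)
  qed
  show "?strip_off \<in> tableaux_to h w (Suc k) v \<rightarrow> ?D"
  proof
    fix T assume T: "T \<in> tableaux_to h w (Suc k) v"
    have last: "T ! (2 * k + 2) = v" using T by (simp add: tableaux_to_def)
    have odd: "T ! (2 * i - 1) \<in> boxed h (w + 1) \<and>
        strip 1 (T ! (2 * i - 2)) (T ! (2 * i - 1)) \<and> strip 1 (T ! (2 * i)) (T ! (2 * i - 1))"
      if "i \<in> {1..Suc k}" for i using T that unfolding tableaux_to_def by blast
    have "take (2 * k + 1) T \<in> tableaux_to h w k (T ! (2 * k))"
      using T odd unfolding tableaux_to_def by auto
    moreover have "T ! (2 * k) \<in> boxed h w"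
      using T unfolding tableaux_to_def by auto
    ultimately show "?strip_off T \<in> ?D" using odd[of "Suc k"] last by simp
  qed
  show "?strip_off (?extend p) = p" if "p \<in> ?D" for p
    using that by (auto simp: tableaux_to_def nth_append)
  show "?extend (?strip_off T) = T" if "T \<in> tableaux_to h w (Suc k) v" for T
  proof -
    have T: "length T = 2 * k + 3" "T ! (2 * k + 2) = v"
      using that by (simp_all add: tableaux_to_def)
    have "drop (2 * k + 1) T = [T ! (2 * k + 1), T ! (2 * k + 2)]"
      using T by (simp add: Cons_nth_drop_Suc[symmetric])
    then have "take (2 * k + 1) T @ [T ! (2 * k + 1), T ! (2 * k + 2)] = T"
      by (metis append_take_drop_id)
    then show ?thesis using T by simp
  qed
qed

lemma finite_tableaux_to:
  "v \<in> boxed h w \<Longrightarrow> finite (tableaux_to h w k v)"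
proof (induction k arbitrary: v)
  case (Suc k)
  show ?case
    by (rule iffD1[OF bij_betw_finite[OF tableaux_to_Suc[OF Suc.prems]]],
        intro finite_SigmaI) (auto simp: Suc.IH)
qed (simp add: tableaux_to_0)

lemma tableau_weight_append:
  assumes T: "T \<in> tableaux_to h w k l" and l: "l \<in> boxed h w" "strip 1 l m"
    and m: "m \<in> boxed h (w + 1)" and v: "v \<in> boxed h w" "strip 1 v m"
  shows "tableau_weight (Suc k) (T @ [m, v]) =
    x (Suc k) ^ card {i. v i \<noteq> m i} * (crest_weight (Suc k) m *
      (x (Suc k) ^ card {i. l i \<noteq> m i} * tableau_weight k T))"
proof -
  have len: "length T = 2 * k + 1" "T ! (2 * k) = l" using T by (auto simp: tableaux_to_def)
  have old: "(T @ [m, v]) ! i = T ! i" if "i \<le> 2 * k" for i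
    using len that by (simp add: nth_append)
  have new: "(T @ [m, v]) ! (2 * k + 1) = m" "(T @ [m, v]) ! (2 * k + 2) = v"
    using len by (simp_all add: nth_append)
  have "weight k x (T @ [m, v]) = weight k x T"
    unfolding weight_def
  proof (rule prod.cong[OF refl])
    fix i assume "i \<in> {1..k}"
    then have "2 * i - 2 \<le> 2 * k" "2 * i - 1 \<le> 2 * k" "2 * i \<le> 2 * k" by auto
    then show "x i powi (- int (psize ((T @ [m, v]) ! (2 * i - 2)))
          + 2 * int (psize ((T @ [m, v]) ! (2 * i - 1))) - int (psize ((T @ [m, v]) ! (2 * i)))) =
        x i powi (- int (psize (T ! (2 * i - 2))) + 2 * int (psize (T ! (2 * i - 1)))
          - int (psize (T ! (2 * i))))" by (simp only: old)
  qed
  then have "weight (Suc k) x (T @ [m, v]) =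
      weight k x T * x (Suc k) powi (- int (psize l) + 2 * int (psize m) - int (psize v))"
    using len new old[of "2 * k"] by (simp add: weight_def)
  also have "- int (psize l) + 2 * int (psize m) - int (psize v) =
      int (card {i. l i \<noteq> m i} + card {i. v i \<noteq> m i})"
    using psize_strip[OF l(1) m l(2)] psize_strip[OF v(1) m v(2)] by simp
  finally have "weight (Suc k) x (T @ [m, v]) =
      weight k x T * x (Suc k) ^ (card {i. l i \<noteq> m i} + card {i. v i \<noteq> m i})"
    by (simp only: power_int_of_nat)
  moreover have "(\<Prod>i = 1..Suc k. crest_weight i ((T @ [m, v]) ! (2 * i - 1))) =
      (\<Prod>i = 1..k. crest_weight i (T ! (2 * i - 1))) * crest_weight (Suc k) m"
  proof -
    have "(\<Prod>i = 1..k. crest_weight i ((T @ [m, v]) ! (2 * i - 1))) =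
        (\<Prod>i = 1..k. crest_weight i (T ! (2 * i - 1)))"
    proof (rule prod.cong[OF refl])
      fix i assume "i \<in> {1..k}"
      then have "2 * i - 1 \<le> 2 * k" by auto
      then show "crest_weight i ((T @ [m, v]) ! (2 * i - 1)) = crest_weight i (T ! (2 * i - 1))"
        by (simp only: old)
    qed
    then show ?thesis using new by simp
  qed
  ultimately show ?thesis
    unfolding tableau_weight_def by (simp add: power_add)
qed

text \<open>The method of images: the walks in the strip have the same generating function as any function
  \<open>g\<close> on all integers that starts alike, satisfies the recurrence of the free walk and has the right
  boundary values. The condition at the bottom says that the weight \<open>\<alpha>\<close> supplies the term
  \<open>x (Suc k) * g k 0\<close>, which in the free walk arrives from outside; the condition at the top says the same
  of \<open>\<beta>\<close> and \<open>x (Suc k) * g k (h + w + 1)\<close>, divided by \<open>x (Suc k)\<close>.\<close>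

lemma walk_eq_reflected:
  fixes g :: "nat \<Rightarrow> int \<Rightarrow> 'a" and i :: int and n :: nat
  assumes wide: "int h + int w \<ge> 2"
    and start: "\<And>y. 1 \<le> y \<Longrightarrow> y \<le> int h + int w \<Longrightarrow> g 0 y = (if y = i then 1 else 0)"
    and interior: "\<And>k y. k < n \<Longrightarrow>
      g (Suc k) y = (1 + x (Suc k) ^ 2) * g k y + x (Suc k) * (g k (y - 1) + g k (y + 1))"
    and bottom: "\<And>k. k < n \<Longrightarrow> \<alpha> (Suc k) * g k 1 = g k 1 + x (Suc k) * g k 0"
    and top: "\<And>k. k < n \<Longrightarrow> \<beta> (Suc k) * x (Suc k) * g k (int h + int w) =
      x (Suc k) * g k (int h + int w) + g k (int h + int w + 1)"
  shows "k \<le> n \<Longrightarrow> 1 \<le> y \<Longrightarrow> y \<le> int h + int w \<Longrightarrow> walk k i y = g k y"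
proof (induction k arbitrary: y)
  case 0
  then show ?case using start[of y] by simp
next
  case (Suc k)
  let ?L = "int h + int w" and ?x = "x (Suc k)"
  have k: "k < n" using Suc.prems by simp
  have IH: "walk k i z = g k z" if "1 \<le> z" "z \<le> ?L" for z
    using Suc.IH[of z] k that by simp
  have below: "crest (Suc k) (walk k) i y = g k y + ?x * g k (y - 1)"
  proof (cases "y = 1")
    case True
    then show ?thesis
      using wide bottom[OF k] by (simp add: crest_def site_def IH walk_outside)
  next
    case False
    then show ?thesis using Suc.prems by (simp add: crest_def site_def IH)
  qed
  have above: "?x * crest (Suc k) (walk k) i (y + 1) = ?x * (g k (y + 1) + ?x * g k y)"
    if "y \<noteq> ?L"
    using that Suc.prems by (simp add: crest_def site_def IH)
  have above_top: "?x * crest (Suc k) (walk k) i (y + 1) = ?x * (g k (y + 1) + ?x * g k y)"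
    if "y = ?L"
  proof -
    have "crest (Suc k) (walk k) i (?L + 1) = \<beta> (Suc k) * ?x * g k ?L"
      using wide IH[of ?L] by (simp add: crest_def site_def walk_outside)
    then show ?thesis using that top[OF k] by (simp add: algebra_simps)
  qed
  have "walk (Suc k) i y = g k y + ?x * g k (y - 1) + ?x * (g k (y + 1) + ?x * g k y)"
    using Suc.prems below above above_top by (cases "y = ?L") auto
  then show ?case using interior[OF k, of y] by (simp add: algebra_simps power2_eq_square)
qed

text \<open>Iterating the expansion of the walker determinant generates all tableaux.\<close>

theorem walker_det_eq_tableau_sum:
  "v \<in> boxed h w \<Longrightarrow>
    walker_det h (walk k) (position h v) = (\<Sum>T\<in>tableaux_to h w k v. tableau_weight k T)"
proof (induction k arbitrary: v)
  case 0
  then show ?case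
    by (simp only: walk_det_0 tableaux_to_0) (simp add: tableau_weight_def weight_def)
next
  case (Suc k)
  let ?x = "x (Suc k)"
  have "walker_det h (walk (Suc k)) (position h v) =
      (\<Sum>m | m \<in> boxed h (w + 1) \<and> strip 1 v m. ?x ^ card {i. v i \<noteq> m i} *
        (crest_weight (Suc k) m * (\<Sum>l | l \<in> boxed h w \<and> strip 1 l m.
          ?x ^ card {i. l i \<noteq> m i} * (\<Sum>T\<in>tableaux_to h w k l. tableau_weight k T))))"
    unfolding walk_det[OF Suc.prems] by (intro sum.cong refl) (simp add: crest_det Suc.IH)
  also have "\<dots> = (\<Sum>m | m \<in> boxed h (w + 1) \<and> strip 1 v m.
      \<Sum>l | l \<in> boxed h w \<and> strip 1 l m. \<Sum>T\<in>tableaux_to h w k l.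
        tableau_weight (Suc k) (T @ [m, v]))"
    using Suc.prems by (simp add: sum_distrib_left tableau_weight_append)
  also have "\<dots> = (\<Sum>(m, l, T)\<in>(SIGMA m:{m \<in> boxed h (w + 1). strip 1 v m}.
       SIGMA l:{l \<in> boxed h w. strip 1 l m}. tableaux_to h w k l). 
        tableau_weight (Suc k) (T @ [m, v]))"
  proof -
    have inner: "(\<Sum>l | l \<in> boxed h w \<and> strip 1 l m. \<Sum>T\<in>tableaux_to h w k l.
          tableau_weight (Suc k) (T @ [m, v])) =
        (\<Sum>(l, T)\<in>(SIGMA l:{l \<in> boxed h w. strip 1 l m}. tableaux_to h w k l).
          tableau_weight (Suc k) (T @ [m, v]))" for m
      by (rule sum.Sigma) (auto simp: finite_tableaux_to)
    show ?thesis
      unfolding inner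
      by (subst sum.Sigma) (auto intro!: finite_SigmaI simp: finite_tableaux_to case_prod_unfold)
  qed
  also have "\<dots> = (\<Sum>T\<in>tableaux_to h w (Suc k) v. tableau_weight (Suc k) T)"
    by (subst sum.reindex_bij_betw[OF tableaux_to_Suc[OF Suc.prems], symmetric])
      (simp add: case_prod_unfold)
  finally show ?case .
qed

end

section \<open>Free walks and their periodic images\<close>

lemma esym_0: "esym 0 x k = (if k = 0 then 1 else 0)"
proof -
  have "{S. S \<subseteq> {1..0::nat} \<and> int (card S) = k} = (if k = 0 then {{}} else {})" by auto
  then show ?thesis by (simp add: esym_def)
qed

lemma esym_Suc: "esym (Suc n) x k = esym n x k + x (Suc n) * esym n x (k - 1)"
proof -
  let ?A = "{S. S \<subseteq> {1..n} \<and> int (card S) = k}" and ?B = "{S. S \<subseteq> {1..n} \<and> int (card S) = k - 1}"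
  have card_insert: "card (insert (Suc n) S) = Suc (card S)" if "S \<subseteq> {1..n}" for S
    using that finite_subset[OF that] by (subst card_insert_disjoint) auto
  have split: "{S. S \<subseteq> {1..Suc n} \<and> int (card S) = k} = ?A \<union> insert (Suc n) ` ?B"
  proof (intro equalityI subsetI)
    fix S assume S: "S \<in> {S. S \<subseteq> {1..Suc n} \<and> int (card S) = k}"
    show "S \<in> ?A \<union> insert (Suc n) ` ?B"
    proof (cases "Suc n \<in> S")
      case True
      let ?S = "S - {Suc n}"
      have "?S \<subseteq> {1..n}" "insert (Suc n) ?S = S" using S True by (auto simp: le_Suc_eq)
      moreover from this have "int (card ?S) = k - 1" using S card_insert[of ?S] by simp
      ultimately show ?thesis by blast
    next
      case False
      then show ?thesis using S by (fastforce simp: le_Suc_eq)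
    qed
  qed (use card_insert in \<open>force simp: le_Suc_eq\<close>)+
  have fin: "finite ?A" "finite ?B" by (auto intro: finite_subset[of _ "Pow {1..n}"])
  have inj: "inj_on (insert (Suc n)) ?B"
  proof (rule inj_onI)
    fix S S' assume "S \<in> ?B" "S' \<in> ?B" "insert (Suc n) S = insert (Suc n) S'"
    moreover from this have "Suc n \<notin> S" "Suc n \<notin> S'" by auto
    ultimately show "S = S'" by (metis insert_ident)
  qed
  have "esym (Suc n) x k = (\<Sum>S\<in>?A. \<Prod>i\<in>S. x i) + (\<Sum>S\<in>insert (Suc n) ` ?B. \<Prod>i\<in>S. x i)"
    unfolding esym_def split by (rule sum.union_disjoint) (use fin in auto)
  also have "(\<Sum>S\<in>insert (Suc n) ` ?B. \<Prod>i\<in>S. x i) = (\<Sum>S\<in>?B. x (Suc n) * (\<Prod>i\<in>S. x i))"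
    unfolding sum.reindex[OF inj] comp_def
  proof (rule sum.cong[OF refl])
    fix S assume "S \<in> ?B"
    then have "finite S" "Suc n \<notin> S" by (auto intro: finite_subset)
    then show "(\<Prod>i\<in>insert (Suc n) S. x i) = x (Suc n) * (\<Prod>i\<in>S. x i)" by simp
  qed
  finally show ?thesis by (simp add: esym_def sum_distrib_left)
qed

lemma esym_outside: "k < 0 \<or> k > int n \<Longrightarrow> esym n x k = 0"
  by (induction n arbitrary: k) (auto simp: esym_0 esym_Suc)

lemma finite_esym_support: "finite {i. esym n x (i + a) * g i \<noteq> 0}"
proof (rule finite_subset)
  show "{i. esym n x (i + a) * g i \<noteq> 0} \<subseteq> {- a..int n - a}"
    using esym_outside[of _ n x] by force
qed simp

lemma esym_correlation: "Sum_any (\<lambda>i. esym n x (i + a) * esym n x (i + b)) = f_sum n x (b - a)"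
  unfolding f_sum_def
  by (rule Sum_any.reindex_cong[of "\<lambda>i. i - a"])
    (auto intro: bij_betw_byWitness[where f' = "\<lambda>i. i + a"] simp: fun_eq_iff algebra_simps)

lemma f_sum_0: "f_sum 0 x r = (if r = 0 then 1 else 0)"
proof -
  have "f_sum 0 x r = Sum_any (\<lambda>i::int. if i = 0 then (if r = 0 then 1 else 0) else 0)"
    unfolding f_sum_def by (rule Sum_any.cong) (simp add: esym_0)
  also have "\<dots> = (if r = 0 then 1 else 0)" by (rule Sum_any.delta)
  finally show ?thesis .
qed

lemma f_sum_uminus: "f_sum n x (- r) = f_sum n x r"
proof -
  have "f_sum n x (- r) = Sum_any (\<lambda>i. esym n x (i + r) * esym n x (i + 0))"
    by (subst esym_correlation) simp
  also have "\<dots> = Sum_any (\<lambda>i. esym n x (i + 0) * esym n x (i + r))" by (simp add: mult.commute)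
  also have "\<dots> = f_sum n x r" by (subst esym_correlation) simp
  finally show ?thesis .
qed

lemma f_sum_outside:
  assumes "\<bar>r\<bar> > int n"
  shows "f_sum n x r = 0"
proof -
  have "esym n x i * esym n x (i + r) = 0" for i
    using assms esym_outside[of i n x] esym_outside[of "i + r" n x] by fastforce
  then show ?thesis by (simp add: f_sum_def del: mult_eq_0_iff)
qed

text \<open>As \<open>f_sum n x r\<close> is the coefficient of \<open>z ^ r\<close> in \<open>\<Prod>k. (1 + x k * z) * (1 + x k / z)\<close>, it
  generates the free walks that end \<open>r\<close> sites from their start. The factor \<open>1 + x (Suc n) ^ 2\<close> stands for
  a last double step that stays at its site or moves up and down again.\<close>

lemma f_sum_Suc:
  "f_sum (Suc n) x r =
    (1 + x (Suc n) ^ 2) * f_sum n x r + x (Suc n) * (f_sum n x (r - 1) + f_sum n x (r + 1))"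
proof -
  let ?X = "x (Suc n)"
  let ?c = "\<lambda>a b i. esym n x (i + a) * esym n x (i + b)"
  have "f_sum (Suc n) x r =
      Sum_any (\<lambda>i. ?c 0 r i + ?X * ?c 0 (r - 1) i + (?X * ?c (- 1) r i + ?X ^ 2 * ?c (- 1) (r - 1) i))"
    unfolding f_sum_def esym_Suc
    by (rule Sum_any.cong) (simp add: algebra_simps power2_eq_square)
  also have "\<dots> = Sum_any (\<lambda>i. ?c 0 r i) + Sum_any (\<lambda>i. ?X * ?c 0 (r - 1) i) +
      (Sum_any (\<lambda>i. ?X * ?c (- 1) r i) + Sum_any (\<lambda>i. ?X ^ 2 * ?c (- 1) (r - 1) i))"
  proof -
    have fin: "finite {i. ?c a b i \<noteq> 0}" "finite {i. y * ?c a b i \<noteq> 0}" for a b y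
      using finite_esym_support[of n x a "\<lambda>i. esym n x (i + b)"]
        finite_esym_support[of n x a "\<lambda>i. y * esym n x (i + b)"] by (simp_all add: ac_simps)
    have fin2: "finite {i. p i + q i \<noteq> 0}" if "finite {i. p i \<noteq> 0}" "finite {i. q i \<noteq> 0}"
      for p q :: "int \<Rightarrow> 'a"
      by (rule finite_subset[OF _ finite_UnI[OF that]]) auto
    show ?thesis
      by (simp only: Sum_any.distrib fin fin2)
  qed
  also have "\<dots> = f_sum n x r + ?X * f_sum n x (r - 1) +
      (?X * f_sum n x (r + 1) + ?X ^ 2 * f_sum n x r)"
    by (simp only: Sum_any_right_distrib[OF finite_esym_support, symmetric] esym_correlation) simp
  finally show ?thesis by (simp add: algebra_simps)
qed

text \<open>The walks to all images of a site under translation by multiples of \<open>N\<close>, with sign \<open>s\<close> for each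
  translation. This covers \<^const>\<open>F_sum\<close> for \<open>s = 1\<close> and \<^const>\<open>Fbar_sum\<close> for \<open>s = - 1\<close>.\<close>

definition image_sum :: "'a \<Rightarrow> int \<Rightarrow> nat \<Rightarrow> (nat \<Rightarrow> 'a::field) \<Rightarrow> int \<Rightarrow> 'a" where
  "image_sum s N n x r = Sum_any (\<lambda>k. s powi k * f_sum n x (r + N * k))"

lemma F_sum_eq_image_sum: "F_sum n x r N = image_sum 1 N n x r"
  by (simp add: F_sum_def image_sum_def)

lemma Fbar_sum_eq_image_sum: "Fbar_sum n x r N = image_sum (- 1) N n x r"
  by (simp add: Fbar_sum_def image_sum_def)

lemma finite_image_support:
  assumes "N > 0"
  shows "finite {k. c k * f_sum n x (r + N * k) \<noteq> 0}"
proof (rule finite_subset)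
  show "{k. c k * f_sum n x (r + N * k) \<noteq> 0} \<subseteq> {- (int n + \<bar>r\<bar>)..int n + \<bar>r\<bar>}"
  proof
    fix k assume "k \<in> {k. c k * f_sum n x (r + N * k) \<noteq> 0}"
    then have "\<bar>r + N * k\<bar> \<le> int n" using f_sum_outside[of n "r + N * k" x] by force
    moreover have "\<bar>k\<bar> \<le> \<bar>N * k\<bar>" using assms mult_right_mono[of 1 N "\<bar>k\<bar>"] by (simp add: abs_mult)
    ultimately show "k \<in> {- (int n + \<bar>r\<bar>)..int n + \<bar>r\<bar>}" by auto
  qed
qed simp

lemma image_sum_Suc:
  assumes "N > 0"
  shows "image_sum s N (Suc n) x r = (1 + x (Suc n) ^ 2) * image_sum s N n x r +
    x (Suc n) * (image_sum s N n x (r - 1) + image_sum s N n x (r + 1))"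
proof -
  let ?X = "x (Suc n)"
  let ?t = "\<lambda>r k. s powi k * f_sum n x (r + N * k)"
  have fin: "finite {k. y * ?t r k \<noteq> 0}" for y r
    using finite_image_support[OF assms, of "\<lambda>k. y * s powi k" n x r] by (simp add: ac_simps)
  have fin1: "finite {k. ?t r k \<noteq> 0}" for r by (rule finite_image_support[OF assms])
  have fin2: "finite {i. p i + q i \<noteq> 0}" if "finite {i. p i \<noteq> 0}" "finite {i. q i \<noteq> 0}"
    for p q :: "int \<Rightarrow> 'a"
    by (rule finite_subset[OF _ finite_UnI[OF that]]) auto
  have "image_sum s N (Suc n) x r =
      Sum_any (\<lambda>k. (1 + ?X ^ 2) * ?t r k + (?X * ?t (r - 1) k + ?X * ?t (r + 1) k))"
    unfolding image_sum_def f_sum_Suc by (rule Sum_any.cong) (simp add: algebra_simps)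
  also have "\<dots> = Sum_any (\<lambda>k. (1 + ?X ^ 2) * ?t r k) + (Sum_any (\<lambda>k. ?X * ?t (r - 1) k) + Sum_any (\<lambda>k. ?X * ?t (r + 1) k))"
    by (simp only: Sum_any.distrib fin fin2)
  also have "\<dots> = (1 + ?X ^ 2) * image_sum s N n x r +
      (?X * image_sum s N n x (r - 1) + ?X * image_sum s N n x (r + 1))"
    by (simp only: image_sum_def Sum_any_right_distrib[OF fin1])
  finally show ?thesis by (simp add: algebra_simps)
qed

lemma image_sum_uminus:
  assumes "s = 1 \<or> s = - 1"
  shows "image_sum s N n x (- r) = image_sum s N n x r"
proof -
  have "image_sum s N n x r = Sum_any (\<lambda>k. s powi (- k) * f_sum n x (r + N * (- k)))"
    unfolding image_sum_def
    by (rule Sum_any.reindex_cong[of "\<lambda>k. - k"]) (auto simp: bij_uminus)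
  also have "\<dots> = image_sum s N n x (- r)"
    unfolding image_sum_def
  proof (rule Sum_any.cong)
    fix k
    have "f_sum n x (r + N * (- k)) = f_sum n x (- r + N * k)"
      using f_sum_uminus[of n x "r + N * (- k)"] by simp
    moreover have "s powi (- k) = s powi k"
      using assms by (auto simp: power_int_minus power_int_minus_one_mult_self power_int_minus_left)
    ultimately show "s powi (- k) * f_sum n x (r + N * (- k)) = s powi k * f_sum n x (- r + N * k)"
      by simp
  qed
  finally show ?thesis by simp
qed

lemma image_sum_shift:
  assumes N: "N > 0" and "s = 1 \<or> s = - 1"
  shows "image_sum s N n x (r + N) = s * image_sum s N n x r"
proof -
  have s: "s \<noteq> 0" "s * s = 1" using assms by auto
  have "image_sum s N n x (r + N) =
      Sum_any (\<lambda>k. s * (s powi (k + 1) * f_sum n x (r + N * (k + 1))))"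
    unfolding image_sum_def
  proof (rule Sum_any.cong)
    fix k
    have "s * s powi (k + 1) = s powi k"
      using s by (simp add: power_int_add_1 mult.left_commute)
    then show "s powi k * f_sum n x (r + N + N * k) = s * (s powi (k + 1) * f_sum n x (r + N * (k + 1)))"
      by (simp add: algebra_simps)
  qed
  also have "\<dots> = Sum_any (\<lambda>k. s * (s powi k * f_sum n x (r + N * k)))"
    by (rule Sum_any.reindex_cong[of "\<lambda>k. k + 1", symmetric])
      (auto intro: bij_betw_byWitness[where f' = "\<lambda>k. k - 1"])
  also have "\<dots> = s * image_sum s N n x r"
    unfolding image_sum_def by (rule Sum_any_right_distrib[OF finite_image_support[OF N], symmetric])
  finally show ?thesis .
qed

text \<open>Evenness and quasi-periodicity together; all boundary conditions at the top site come from this.\<close>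

lemma image_sum_reflect:
  assumes "N > 0" and "s = 1 \<or> s = - 1" and "a + b = N"
  shows "image_sum s N n x a = s * image_sum s N n x b"
proof -
  have "a = - b + N" using assms(3) by simp
  then show ?thesis by (simp only: image_sum_shift[OF assms(1,2)] image_sum_uminus[OF assms(2)])
qed

lemma image_sum_0:
  assumes "- N < r" "r < N"
  shows "image_sum s N 0 x r = (if r = 0 then 1 else 0)"
proof -
  have "r + N * k = 0 \<longleftrightarrow> k = 0 \<and> r = 0" for k
  proof
    assume *: "r + N * k = 0"
    have "k = 0"
    proof (rule ccontr)
      assume "k \<noteq> 0"
      then have "N * 1 \<le> N * \<bar>k\<bar>" using assms by (intro mult_left_mono) auto
      moreover have "\<bar>r\<bar> = N * \<bar>k\<bar>"
      proof -
        have "r = - (N * k)" using * by simp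
        then show ?thesis using assms by (simp add: abs_mult)
      qed
      ultimately show False using assms by linarith
    qed
    then show "k = 0 \<and> r = 0" using * by simp
  qed simp
  then have "image_sum s N 0 x r = Sum_any (\<lambda>k::int. if k = 0 then (if r = 0 then 1 else 0) else 0)"
    unfolding image_sum_def by (intro Sum_any.cong) (simp add: f_sum_0)
  also have "\<dots> = (if r = 0 then 1 else 0)" by (rule Sum_any.delta)
  finally show ?thesis .
qed

section \<open>Up-down tableaux as nonintersecting walks\<close>

lemma num_rows_le_iff:
  assumes "antimono l" "finite {i. l i \<noteq> 0}"
  shows "num_rows l \<le> h \<longleftrightarrow> (\<forall>i\<ge>h. l i = 0)"
proof
  assume rows: "num_rows l \<le> h"
  show "\<forall>i\<ge>h. l i = 0"
  proof (intro allI impI, rule ccontr)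
    fix i assume "i \<ge> h" "l i \<noteq> 0"
    then have "{..i} \<subseteq> {i. l i \<noteq> 0}"
      using antimonoD[OF assms(1)] by fastforce
    then have "card {..i} \<le> num_rows l"
      unfolding num_rows_def using assms(2) by (rule card_mono[rotated])
    then show False using rows \<open>i \<ge> h\<close> by simp
  qed
next
  assume "\<forall>i\<ge>h. l i = 0"
  then have "{i. l i \<noteq> 0} \<subseteq> {..<h}" by (force simp: not_less[symmetric])
  then show "num_rows l \<le> h"
    unfolding num_rows_def using card_mono[of "{..<h}"] by fastforce
qed

lemma mem_boxed_iff:
  "l \<in> boxed h a \<longleftrightarrow> is_partition l \<and> num_rows l \<le> h \<and> num_cols l \<le> a"
proof
  assume l: "l \<in> boxed h a"
  then have "{i. l i \<noteq> 0} \<subseteq> {..<h}" by (force simp: boxed_def not_less[symmetric])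
  then have "finite {i. l i \<noteq> 0}" by (rule finite_subset) simp
  then show "is_partition l \<and> num_rows l \<le> h \<and> num_cols l \<le> a"
    using l num_rows_le_iff[of l h] by (simp add: boxed_def is_partition_def num_cols_def part_def)
next
  assume l: "is_partition l \<and> num_rows l \<le> h \<and> num_cols l \<le> a"
  then have "l i \<le> a" for i
    using antimonoD[of l 0 i] by (simp add: is_partition_def num_cols_def part_def)
  then show "l \<in> boxed h a"
    using l num_rows_le_iff[of l h] by (simp add: boxed_def is_partition_def)
qed

lemma young_mono_iff: "young l \<subseteq> young m \<longleftrightarrow> (\<forall>i. l i \<le> m i)"
proof
  assume sub: "young l \<subseteq> young m"
  show "\<forall>i. l i \<le> m i"
  proof (rule allI, rule ccontr)
    fix i assume "\<not> l i \<le> m i"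
    then have "(i, m i) \<in> young l" by (simp add: young_def)
    then have "(i, m i) \<in> young m" using sub by blast
    then show False by (simp add: young_def)
  qed
qed (auto simp: young_def intro: order.strict_trans2)

lemma differ_by_vertical_strip_commute:
  "differ_by_vertical_strip l m \<longleftrightarrow> differ_by_vertical_strip m l"
  unfolding differ_by_vertical_strip_def by (simp only: Un_commute)

lemma vertical_strip_iff:
  "young l \<subseteq> young m \<and> differ_by_vertical_strip l m \<longleftrightarrow> strip 1 l m"
proof
  assume asm: "young l \<subseteq> young m \<and> differ_by_vertical_strip l m"
  show "strip 1 l m"
    unfolding strip_def
  proof
    fix i
    have le: "l i \<le> m i" using asm by (simp add: young_mono_iff)
    have "m i \<le> l i + 1"
    proof (rule ccontr)
      assume "\<not> ?thesis"
      then have "(i, l i) \<in> young m - young l" "(i, l i + 1) \<in> young m - young l"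
        by (auto simp: young_def)
      then show False
        using asm unfolding differ_by_vertical_strip_def by (metis UnI2 add_cancel_right_right zero_neq_one)
    qed
    then show "int (m i) = int (l i) \<or> int (m i) = int (l i) + 1" using le by auto
  qed
next
  assume s: "strip 1 l m"
  have bounds: "l i \<le> m i" "m i \<le> l i + 1" for i
  proof -
    have "int (m i) = int (l i) \<or> int (m i) = int (l i) + 1" using s by (simp add: strip_def)
    then show "l i \<le> m i" "m i \<le> l i + 1" by auto
  qed
  have "j = l i" if "(i, j) \<in> (young l - young m) \<union> (young m - young l)" for i j
    using that bounds[of i] by (auto simp: young_def)
  then have "differ_by_vertical_strip l m"
    unfolding differ_by_vertical_strip_def by metis
  then show "young l \<subseteq> young m \<and> differ_by_vertical_strip l m"
    using bounds by (simp add: young_mono_iff)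
qed

lemma empty_partition_boxed: "empty_partition \<in> boxed h a"
  by (auto simp: boxed_def empty_partition_def antimono_def)

lemma UD_eq_tableaux_to: "UD n h w = tableaux_to h w n empty_partition"
proof (intro equalityI subsetI)
  fix T assume T: "T \<in> UD n h w"
  have partition: "is_partition (T ! i)" if "i \<le> 2 * n" for i
    using T that unfolding UD_def by auto
  have rows: "num_rows (T ! i) \<le> h" if "i \<in> {1..2 * n}" for i
    using T that unfolding UD_def by auto
  have even: "T ! (2 * i) \<in> boxed h w" if "i \<le> n" for i
  proof (cases "i = 0")
    case True
    then show ?thesis using T by (simp add: UD_def empty_partition_boxed)
  next
    case False
    then have "i \<in> {1..n}" using that by auto
    then have "num_cols (T ! (2 * i)) \<le> w" using T unfolding UD_def by blast
    then show ?thesis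
      using False that partition[of "2 * i"] rows[of "2 * i"] by (simp add: mem_boxed_iff)
  qed
  have strips: "strip 1 (T ! (2 * i - 2)) (T ! (2 * i - 1)) \<and> strip 1 (T ! (2 * i)) (T ! (2 * i - 1))"
    if i: "i \<in> {1..n}" for i
  proof -
    have "young (T ! (2 * i - 2)) \<subseteq> young (T ! (2 * i - 1)) \<and> young (T ! (2 * i)) \<subseteq> young (T ! (2 * i - 1))"
      using T i unfolding UD_def by blast
    moreover have differ: "differ_by_vertical_strip (T ! (j - 1)) (T ! j)" if "j \<in> {1..2 * n}" for j
      using T that unfolding UD_def by blast
    have "differ_by_vertical_strip (T ! (2 * i - 1)) (T ! (2 * i))"
      using i by (intro differ) auto
    moreover have "differ_by_vertical_strip (T ! (2 * i - 2)) (T ! (2 * i - 1))"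
    proof -
      have "2 * i - 1 \<in> {1..2 * n}" "2 * i - 1 - 1 = 2 * i - 2" using i by auto
      then show ?thesis using differ[of "2 * i - 1"] by simp
    qed
    ultimately show ?thesis
      using vertical_strip_iff differ_by_vertical_strip_commute by blast
  qed
  have odd: "T ! (2 * i - 1) \<in> boxed h (w + 1)" if i: "i \<in> {1..n}" for i
  proof -
    have "T ! (2 * (i - 1)) \<in> boxed h w" using i by (intro even) auto
    then have "(T ! (2 * i - 2)) 0 \<le> w" by (simp add: boxed_def right_diff_distrib')
    moreover have "int ((T ! (2 * i - 1)) 0) = int ((T ! (2 * i - 2)) 0) \<or>
        int ((T ! (2 * i - 1)) 0) = int ((T ! (2 * i - 2)) 0) + 1"
      using strips[OF i] by (simp add: strip_def)
    ultimately have "num_cols (T ! (2 * i - 1)) \<le> w + 1" by (auto simp: num_cols_def part_def)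
    then show ?thesis
      using partition[of "2 * i - 1"] rows[of "2 * i - 1"] i unfolding mem_boxed_iff by fastforce
  qed
  show "T \<in> tableaux_to h w n empty_partition"
  proof -
    have "length T = 2 * n + 1" "T ! 0 = empty_partition" "T ! (2 * n) = empty_partition"
      using T by (simp_all add: UD_def)
    then show ?thesis unfolding tableaux_to_def using even odd strips by auto
  qed
next
  fix T assume T: "T \<in> tableaux_to h w n empty_partition"
  have even: "T ! (2 * i) \<in> boxed h w" if "i \<le> n" for i
    using T that unfolding tableaux_to_def by blast
  have odd: "T ! (2 * i - 1) \<in> boxed h (w + 1)" "strip 1 (T ! (2 * i - 2)) (T ! (2 * i - 1))"
    "strip 1 (T ! (2 * i)) (T ! (2 * i - 1))" if "i \<in> {1..n}" for i
    using T that unfolding tableaux_to_def by blast+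
  have parity: "(\<exists>k\<in>{1..n}. j = 2 * k) \<or> (\<exists>k\<in>{1..n}. j = 2 * k - 1)" if "j \<in> {1..2 * n}" for j
  proof (cases "even j")
    case True
    then show ?thesis using that by (auto elim!: evenE)
  next
    case False
    then obtain k where "j = 2 * k + 1" by (elim oddE)
    then have "k + 1 \<in> {1..n}" "j = 2 * (k + 1) - 1" using that by auto
    then show ?thesis by blast
  qed
  have shape: "is_partition (T ! j) \<and> num_rows (T ! j) \<le> h" if "j \<in> {1..2 * n}" for j
    using parity[OF that] even odd(1) by (auto simp: mem_boxed_iff)
  have "is_partition l" if l: "l \<in> set T" for l
  proof -
    obtain j where j: "j < length T" "l = T ! j" using l by (auto simp: in_set_conv_nth)
    show ?thesis
    proof (cases "j = 0")
      case True
      then show ?thesis using even[of 0] j by (simp add: mem_boxed_iff)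
    next
      case False
      then have "j \<in> {1..2 * n}" using j T by (auto simp: tableaux_to_def)
      then show ?thesis using shape j by blast
    qed
  qed
  moreover have "differ_by_vertical_strip (T ! (j - 1)) (T ! j)" if "j \<in> {1..2 * n}" for j
    using parity[OF that]
  proof
    assume "\<exists>k\<in>{1..n}. j = 2 * k"
    then show ?thesis
      using odd(3) vertical_strip_iff differ_by_vertical_strip_commute by blast
  next
    assume "\<exists>k\<in>{1..n}. j = 2 * k - 1"
    then obtain k where k: "k \<in> {1..n}" "j = 2 * k - 1" by blast
    then have "j - 1 = 2 * k - 2" by simp
    then show ?thesis using odd(2)[OF k(1)] k(2) vertical_strip_iff by metis
  qed
  moreover have "num_cols (T ! (2 * i)) \<le> w" if "i \<in> {1..n}" for i
    using even[of i] that by (simp add: mem_boxed_iff)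
  moreover have "young (T ! (2 * i - 2)) \<subseteq> young (T ! (2 * i - 1)) \<and>
      young (T ! (2 * i)) \<subseteq> young (T ! (2 * i - 1))" if "i \<in> {1..n}" for i
    using odd[OF that] vertical_strip_iff by blast
  moreover have "length T = 2 * n + 1" "T ! 0 = empty_partition" "T ! (2 * n) = empty_partition"
    using T by (simp_all add: tableaux_to_def)
  ultimately show "T \<in> UD n h w"
    unfolding UD_def using shape by (intro CollectI conjI ballI) auto
qed

lemma finite_UD: "finite (UD n h w)" if "h \<ge> 1"
proof -
  interpret boundary_weighted_walks h w "\<lambda>_. 1 :: real" "\<lambda>_. 1" "\<lambda>_. 1" by unfold_locales fact
  show ?thesis
    unfolding UD_eq_tableaux_to by (rule finite_tableaux_to[OF empty_partition_boxed])
qed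

text \<open>Summing over the marked sets turns the marks into a factor for each admissible element.\<close>

lemma sum_marked_subsets:
  fixes a :: "'b \<Rightarrow> 'a::field"
  assumes "finite A"
  shows "(\<Sum>M | M \<subseteq> A \<and> (\<forall>j\<in>M. C j). \<Prod>j\<in>M. a j) = (\<Prod>j\<in>A. if C j then 1 + a j else 1)"
proof -
  let ?B = "{j \<in> A. C j}"
  have "(\<Prod>j\<in>A. if C j then 1 + a j else 1) = (\<Prod>j\<in>?B. a j + 1)"
    using assms by (simp add: prod.inter_filter add.commute)
  also have "\<dots> = (\<Sum>M\<in>Pow ?B. (\<Prod>j\<in>M. a j) * (\<Prod>j\<in>?B - M. 1))"
    using assms by (intro prod_add) simp
  also have "Pow ?B = {M. M \<subseteq> A \<and> (\<forall>j\<in>M. C j)}" by auto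
  finally show ?thesis by simp
qed

context boundary_weighted_walks
begin

text \<open>The common form of the three identities. The images of the site \<open>i\<close> are
  \<open>i + N * k\<close> with sign \<open>s ^ k\<close> and \<open>d - i + N * k\<close> with sign \<open>t * s ^ k\<close>. The bound on \<open>N\<close> keeps all
  images other than \<open>i\<close> itself out of the sites \<open>1, \<dots>, h + w\<close>; the other two hypotheses are the
  boundary conditions for the images.\<close>

lemma det1_image_sums:
  fixes s t :: 'a and N d :: int
  assumes w_pos: "w \<ge> 1" and s: "s = 1 \<or> s = - 1" and d: "d = 0 \<or> d = 1"
    and N: "2 * int (h + w) - d < N"
    and bottom: "\<And>i k. k < n \<Longrightarrow> \<alpha> (Suc k) * (image_sum s N k x (- i + 1) + t * image_sum s N k x (i + 1 - d)) =
      (image_sum s N k x (- i + 1) + t * image_sum s N k x (i + 1 - d)) +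
      x (Suc k) * (image_sum s N k x (- i) + t * image_sum s N k x (i - d))"
    and top: "\<And>i k L. k < n \<Longrightarrow> L = int (h + w) \<Longrightarrow>
      \<beta> (Suc k) * x (Suc k) * (image_sum s N k x (- i + L) + t * image_sum s N k x (i + L - d)) =
      x (Suc k) * (image_sum s N k x (- i + L) + t * image_sum s N k x (i + L - d)) +
      (image_sum s N k x (- i + (L + 1)) + t * image_sum s N k x (i + (L + 1) - d))"
  shows "det1 h (\<lambda>i j. image_sum s N n x (- i + j) + t * image_sum s N n x (i + j - d)) =
    (\<Sum>T\<in>UD n h w. tableau_weight n T)"
proof -
  let ?g = "\<lambda>i k y. image_sum s N k x (- i + y) + t * image_sum s N k x (i + y - d)"
  have "N > 0" using N d w_pos by auto
  have walk: "walk n i y = ?g i n y"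
    if i: "1 \<le> i" "i \<le> int h" and y: "1 \<le> y" "y \<le> int h + int w" for i y
  proof (rule walk_eq_reflected[where n = n and g = "?g i" and i = i])
    show "?g i 0 y = (if y = i then 1 else 0)" if "1 \<le> y" "y \<le> int h + int w" for y
    proof -
      have "image_sum s N 0 x (- i + y) = (if - i + y = 0 then 1 else 0)"
        using that i N d w_pos by (intro image_sum_0) auto
      moreover have "image_sum s N 0 x (i + y - d) = (if i + y - d = 0 then 1 else 0)"
        using that i N d w_pos by (intro image_sum_0) auto
      ultimately show ?thesis using that i d by auto
    qed
    show "?g i (Suc k) y = (1 + x (Suc k) ^ 2) * ?g i k y + x (Suc k) * (?g i k (y - 1) + ?g i k (y + 1))"
      for k y
      by (simp add: image_sum_Suc[OF \<open>N > 0\<close>] algebra_simps)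
    show "\<alpha> (Suc k) * ?g i k 1 = ?g i k 1 + x (Suc k) * ?g i k 0" if "k < n" for k
      using bottom[OF that, of i] by simp
    show "\<beta> (Suc k) * x (Suc k) * ?g i k (int h + int w) =
        x (Suc k) * ?g i k (int h + int w) + ?g i k (int h + int w + 1)" if "k < n" for k
      using top[OF that, of "int h + int w" i] by simp
  qed (use h_pos w_pos y in auto)
  have "det1 h (\<lambda>i j. ?g i n j) = walker_det h (walk n) (position h empty_partition)"
    unfolding det1_def walker_det_def
  proof (intro arg_cong[where f = det] eq_matI)
    fix i j assume "i < dim_row (mat h h (\<lambda>(i, j). walk n (int i + 1) (position h empty_partition j)))"
      "j < dim_col (mat h h (\<lambda>(i, j). walk n (int i + 1) (position h empty_partition j)))"
    then show "mat h h (\<lambda>(i, j). ?g (int i + 1) n (int j + 1)) $$ (i, j) =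
        mat h h (\<lambda>(i, j). walk n (int i + 1) (position h empty_partition j)) $$ (i, j)"
      using walk[of "int i + 1" "int j + 1"] by (simp add: position_def empty_partition_def)
  qed auto
  also have "\<dots> = (\<Sum>T\<in>UD n h w. tableau_weight n T)"
    unfolding UD_eq_tableaux_to by (rule walker_det_eq_tableau_sum[OF empty_partition_boxed])
  finally show ?thesis .
qed

end

section \<open>Marked tableaux and the three identities\<close>

lemma UD_wstar_sum:
  fixes x :: "nat \<Rightarrow> 'a::field"
  assumes "h \<ge> 1"
  shows "(\<Sum>TM\<in>UD_wstar n h w. weight_wstar n x TM) = (\<Sum>T\<in>UD n h w. weight n x T *
    (\<Prod>j = 1..n. if part (T ! (2 * j - 1)) 1 = w + 1 then 1 - 1 / x j else 1))"
proof -
  let ?M = "\<lambda>T. {M. M \<subseteq> {1..n} \<and> (\<forall>j\<in>M. part (T ! (2 * j - 1)) 1 = w + 1)}"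
  have "UD_wstar n h w = Sigma (UD n h w) ?M" by (auto simp: UD_wstar_def)
  then have "(\<Sum>TM\<in>UD_wstar n h w. weight_wstar n x TM) =
      (\<Sum>T\<in>UD n h w. \<Sum>M\<in>?M T. weight n x T * (\<Prod>j\<in>M. - (1 / x j)))"
    by (simp add: sum.Sigma finite_UD[OF assms] weight_wstar_def)
  also have "\<dots> = (\<Sum>T\<in>UD n h w. weight n x T *
      (\<Prod>j = 1..n. if part (T ! (2 * j - 1)) 1 = w + 1 then 1 + - (1 / x j) else 1))"
    by (simp only: sum_distrib_left[symmetric] sum_marked_subsets[OF finite_atLeastAtMost])
  finally show ?thesis by (simp only: diff_conv_add_uminus)
qed

lemma UD_hstar_sum:
  fixes x :: "nat \<Rightarrow> 'a::field"
  assumes "h \<ge> 1"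
  shows "(\<Sum>TM\<in>UD_hstar n h w. weight_hstar n x TM) = (\<Sum>T\<in>UD n h w. weight n x T *
    (\<Prod>j = 1..n. if part (T ! (2 * j - 1)) h = 0 then 1 + x j else 1))"
proof -
  let ?M = "\<lambda>T. {M. M \<subseteq> {1..n} \<and> (\<forall>j\<in>M. part (T ! (2 * j - 1)) h = 0)}"
  have "UD_hstar n h w = Sigma (UD n h w) ?M" by (auto simp: UD_hstar_def)
  then have "(\<Sum>TM\<in>UD_hstar n h w. weight_hstar n x TM) =
      (\<Sum>T\<in>UD n h w. \<Sum>M\<in>?M T. weight n x T * (\<Prod>j\<in>M. x j))"
    by (simp add: sum.Sigma finite_UD[OF assms] weight_hstar_def)
  then show ?thesis
    by (simp only: sum_distrib_left[symmetric] sum_marked_subsets[OF finite_atLeastAtMost])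
qed

lemma UD_hwstar_sum:
  fixes x :: "nat \<Rightarrow> 'a::field"
  assumes "h \<ge> 1"
  shows "(\<Sum>TM\<in>UD_hwstar n h w. weight_hwstar n x TM) = (\<Sum>T\<in>UD n h w. weight n x T *
    ((\<Prod>j = 1..n. if part (T ! (2 * j - 1)) h = 0 then 1 + x j else 1) *
     (\<Prod>j = 1..n. if part (T ! (2 * j - 1)) 1 = w + 1 then 1 - 1 / x j else 1)))"
proof -
  let ?M1 = "\<lambda>T. {M. M \<subseteq> {1..n} \<and> (\<forall>j\<in>M. part (T ! (2 * j - 1)) h = 0)}"
  let ?M2 = "\<lambda>T. {M. M \<subseteq> {1..n} \<and> (\<forall>j\<in>M. part (T ! (2 * j - 1)) 1 = w + 1)}"
  have "UD_hwstar n h w = (SIGMA T:UD n h w. ?M1 T \<times> ?M2 T)" by (auto simp: UD_hwstar_def)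
  then have "(\<Sum>TM\<in>UD_hwstar n h w. weight_hwstar n x TM) =
      (\<Sum>T\<in>UD n h w. \<Sum>(M1, M2)\<in>?M1 T \<times> ?M2 T.
        weight n x T * ((\<Prod>j\<in>M1. x j) * (\<Prod>j\<in>M2. - (1 / x j))))"
    by (simp add: sum.Sigma finite_UD[OF assms] weight_hwstar_def case_prod_unfold mult.assoc)
  also have "\<dots> = (\<Sum>T\<in>UD n h w. weight n x T *
      ((\<Sum>M\<in>?M1 T. \<Prod>j\<in>M. x j) * (\<Sum>M\<in>?M2 T. \<Prod>j\<in>M. - (1 / x j))))"
    by (simp only: sum_product sum.cartesian_product)
      (simp only: sum_distrib_left case_prod_unfold)
  also have "\<dots> = (\<Sum>T\<in>UD n h w. weight n x T *
      ((\<Prod>j = 1..n. if part (T ! (2 * j - 1)) h = 0 then 1 + x j else 1) *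
       (\<Prod>j = 1..n. if part (T ! (2 * j - 1)) 1 = w + 1 then 1 + - (1 / x j) else 1)))"
    by (simp only: sum_marked_subsets[OF finite_atLeastAtMost])
  finally show ?thesis by (simp only: diff_conv_add_uminus)
qed

theorem theorem7p6:
  fixes x :: "nat \<Rightarrow> 'a::field" and h w n :: nat
  assumes "h \<ge> 1" and "w \<ge> 1" and "n \<ge> 1"
    and "\<And>i. i \<in> {1..n} \<Longrightarrow> x i \<noteq> 0"
  shows
    "det1 h (\<lambda>i j. F_sum n x (- i + j) (2 * int h + 2 * int w + 1)
                 - F_sum n x (i + j) (2 * int h + 2 * int w + 1))
       = (\<Sum>TM \<in> UD_wstar n h w. weight_wstar n x TM) \<and>
     det1 h (\<lambda>i j. Fbar_sum n x (- i + j) (2 * int h + 2 * int w + 1)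
                 + Fbar_sum n x (i + j - 1) (2 * int h + 2 * int w + 1))
       = (\<Sum>TM \<in> UD_hstar n h w. weight_hstar n x TM) \<and>
     det1 h (\<lambda>i j. Fbar_sum n x (- i + j) (2 * int h + 2 * int w)
                 + Fbar_sum n x (i + j - 1) (2 * int h + 2 * int w))
       = (\<Sum>TM \<in> UD_hwstar n h w. weight_hwstar n x TM)"
proof (intro conjI)
  let ?L = "int (h + w)"
  have L: "?L \<ge> 2" using assms by simp
  have x: "x (Suc k) \<noteq> 0" if "k < n" for k using that assms(4)[of "Suc k"] by auto
  have even: "image_sum s N k x (- r) = image_sum s N k x r" if "s = 1 \<or> s = - 1" for s N k r
    by (rule image_sum_uminus[OF that])

  let ?N = "2 * int h + 2 * int w + 1"
  \<comment> \<open>Walks that vanish at the site 0 and are antisymmetric about \<open>h + w + 1/2\<close>.\<close>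
  interpret top: boundary_weighted_walks h w x "\<lambda>_. 1" "\<lambda>k. 1 - 1 / x k"
    by unfold_locales fact
  have "det1 h (\<lambda>i j. image_sum 1 ?N n x (- i + j) + (- 1) * image_sum 1 ?N n x (i + j - 0)) =
      (\<Sum>T\<in>UD n h w. top.tableau_weight n T)"
  proof (rule top.det1_image_sums)
    show "(1 - 1 / x (Suc k)) * x (Suc k) *
          (image_sum 1 ?N k x (- i + L) + (- 1) * image_sum 1 ?N k x (i + L - 0)) =
        x (Suc k) * (image_sum 1 ?N k x (- i + L) + (- 1) * image_sum 1 ?N k x (i + L - 0)) +
        (image_sum 1 ?N k x (- i + (L + 1)) + (- 1) * image_sum 1 ?N k x (i + (L + 1) - 0))"
      if k: "k < n" and "L = ?L" for i L k
    proof -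
      have "image_sum 1 ?N k x (- i + (L + 1)) = image_sum 1 ?N k x (i + L)"
        using image_sum_reflect[of ?N 1 "- i + (L + 1)" "i + L" k x] that by simp
      moreover have "image_sum 1 ?N k x (i + (L + 1)) = image_sum 1 ?N k x (- i + L)"
        using image_sum_reflect[of ?N 1 "i + (L + 1)" "- i + L" k x] that by simp
      moreover have "(1 - 1 / x (Suc k)) * x (Suc k) = x (Suc k) - 1"
        using x[OF k] by (simp add: field_simps)
      ultimately show ?thesis by (simp add: algebra_simps)
    qed
  qed (use assms even[of 1] in auto)
  then show "det1 h (\<lambda>i j. F_sum n x (- i + j) ?N - F_sum n x (i + j) ?N) =
      (\<Sum>TM \<in> UD_wstar n h w. weight_wstar n x TM)"
    by (simp add: F_sum_eq_image_sum UD_wstar_sum[OF assms(1)] top.tableau_weight_def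
        top.crest_weight_def)

  \<comment> \<open>Walks that are symmetric about \<open>1/2\<close> and vanish at the site \<open>h + w + 1\<close>.\<close>
  interpret bottom: boundary_weighted_walks h w x "\<lambda>k. 1 + x k" "\<lambda>_. 1"
    by unfold_locales fact
  have "det1 h (\<lambda>i j. image_sum (- 1) ?N n x (- i + j) + 1 * image_sum (- 1) ?N n x (i + j - 1)) =
      (\<Sum>T\<in>UD n h w. bottom.tableau_weight n T)"
  proof (rule bottom.det1_image_sums)
    show "1 * x (Suc k) *
          (image_sum (- 1) ?N k x (- i + L) + 1 * image_sum (- 1) ?N k x (i + L - 1)) =
        x (Suc k) * (image_sum (- 1) ?N k x (- i + L) + 1 * image_sum (- 1) ?N k x (i + L - 1)) +
        (image_sum (- 1) ?N k x (- i + (L + 1)) + 1 * image_sum (- 1) ?N k x (i + (L + 1) - 1))"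
      if "L = ?L" for i L k
      using image_sum_reflect[of ?N "- 1" "- i + (L + 1)" "i + L" k x] that by simp
    show "(1 + x (Suc k)) *
          (image_sum (- 1) ?N k x (- i + 1) + 1 * image_sum (- 1) ?N k x (i + 1 - 1)) =
        (image_sum (- 1) ?N k x (- i + 1) + 1 * image_sum (- 1) ?N k x (i + 1 - 1)) +
        x (Suc k) * (image_sum (- 1) ?N k x (- i) + 1 * image_sum (- 1) ?N k x (i - 1))" for i k
      using even[of "- 1" ?N k i] even[of "- 1" ?N k "i - 1"] by (simp add: algebra_simps)
  qed (use assms in auto)
  then show "det1 h (\<lambda>i j. Fbar_sum n x (- i + j) ?N + Fbar_sum n x (i + j - 1) ?N) =
      (\<Sum>TM \<in> UD_hstar n h w. weight_hstar n x TM)"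
    by (simp add: Fbar_sum_eq_image_sum UD_hstar_sum[OF assms(1)] bottom.tableau_weight_def
        bottom.crest_weight_def)

  let ?N = "2 * int h + 2 * int w"
  \<comment> \<open>Walks that are symmetric about \<open>1/2\<close> and antisymmetric about \<open>h + w + 1/2\<close>.\<close>
  interpret both: boundary_weighted_walks h w x "\<lambda>k. 1 + x k" "\<lambda>k. 1 - 1 / x k"
    by unfold_locales fact
  have "det1 h (\<lambda>i j. image_sum (- 1) ?N n x (- i + j) + 1 * image_sum (- 1) ?N n x (i + j - 1)) =
      (\<Sum>T\<in>UD n h w. both.tableau_weight n T)"
  proof (rule both.det1_image_sums)
    show "(1 - 1 / x (Suc k)) * x (Suc k) *
          (image_sum (- 1) ?N k x (- i + L) + 1 * image_sum (- 1) ?N k x (i + L - 1)) =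
        x (Suc k) * (image_sum (- 1) ?N k x (- i + L) + 1 * image_sum (- 1) ?N k x (i + L - 1)) +
        (image_sum (- 1) ?N k x (- i + (L + 1)) + 1 * image_sum (- 1) ?N k x (i + (L + 1) - 1))"
      if k: "k < n" and "L = ?L" for i L k
    proof -
      have "image_sum (- 1) ?N k x (- i + (L + 1)) = - image_sum (- 1) ?N k x (i + L - 1)"
        using image_sum_reflect[of ?N "- 1" "- i + (L + 1)" "i + L - 1" k x] that L by simp
      moreover have "image_sum (- 1) ?N k x (i + L) = - image_sum (- 1) ?N k x (- i + L)"
        using image_sum_reflect[of ?N "- 1" "i + L" "- i + L" k x] that L by simp
      moreover have "(1 - 1 / x (Suc k)) * x (Suc k) = x (Suc k) - 1"
        using x[OF k] by (simp add: field_simps)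
      ultimately show ?thesis by (simp add: algebra_simps)
    qed
    show "(1 + x (Suc k)) *
          (image_sum (- 1) ?N k x (- i + 1) + 1 * image_sum (- 1) ?N k x (i + 1 - 1)) =
        (image_sum (- 1) ?N k x (- i + 1) + 1 * image_sum (- 1) ?N k x (i + 1 - 1)) +
        x (Suc k) * (image_sum (- 1) ?N k x (- i) + 1 * image_sum (- 1) ?N k x (i - 1))" for i k
      using even[of "- 1" ?N k i] even[of "- 1" ?N k "i - 1"] by (simp add: algebra_simps)
  qed (use assms in auto)
  then show "det1 h (\<lambda>i j. Fbar_sum n x (- i + j) ?N + Fbar_sum n x (i + j - 1) ?N) =
      (\<Sum>TM \<in> UD_hwstar n h w. weight_hwstar n x TM)"
    by (simp add: Fbar_sum_eq_image_sum UD_hwstar_sum[OF assms(1)] both.tableau_weight_def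
        both.crest_weight_def prod.distrib)
qed

end
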